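(* Let $k,\ell\ge 1$ be integers, let $a_1,\dots,a_k$ and $b_{11},\dots,b_{1\ell},\dots,b_{k1},\dots,b_{k\ell}$ be fixed non-zero integers. For $c\in\mathbb Z$ consider the exponential diophantine equation $$a_1 b_{11}^{\alpha_{11}}\cdots b_{1\ell}^{\alpha_{1\ell}}+\dots+a_k b_{k1}^{\alpha_{k1}}\cdots b_{k\ell}^{\alpha_{k\ell}}=c \qquad (E_c)$$ in non-negative integers $\alpha_{ij}$, and for an integer $m\ge 2$ the congruence $$a_1 b_{11}^{\alpha_{11}}\cdots b_{1\ell}^{\alpha_{1\ell}}+\dots+a_k b_{k1}^{\alpha_{k1}}\cdots b_{k\ell}^{\alpha_{k\ell}}\equiv c \pmod m \qquad (E_{c,m})$$ in non-negative integers $\alpha_{ij}$. Let $$H_0=\{c\in\mathbb Z:\ (E_c)\text{ has no solution}\},$$ $$H=\{c\in\mathbb Z:\ (E_c)\text{ has no solution, but } (E_{c,m}) \text{ is solvable for every integer } m\ge 2\}.$$ Then $H$ has density zero inside $H_0$, i.e. $$\lim_{x\to\infty}\frac{\#\{c\in H: |c|\le x\}}{\#\{c\in H_0:|c|\le x\}}=0.$$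
   Context: $\#C$ denotes the number of elements of a finite set $C$. For sets $A\subseteq B\subseteq\mathbb Z$, the density of $A$ inside $B$ is $\lim_{x\to\infty}\#\{a\in A:|a|\le x\}/\#\{b\in B:|b|\le x\}$, when this limit exists. *)

theory Defs
  imports "HOL-Analysis.Analysis" "HOL-Number_Theory.Cong"
begin

definition exp_lhs :: "nat \<Rightarrow> nat \<Rightarrow> (nat \<Rightarrow> int) \<Rightarrow> (nat \<Rightarrow> nat \<Rightarrow> int) \<Rightarrow> (nat \<Rightarrow> nat \<Rightarrow> nat) \<Rightarrow> int" where
  "exp_lhs k l a b \<alpha> = (\<Sum>i<k. a i * (\<Prod>j<l. b i j ^ \<alpha> i j))"

definition eq_solvable :: "nat \<Rightarrow> nat \<Rightarrow> (nat \<Rightarrow> int) \<Rightarrow> (nat \<Rightarrow> nat \<Rightarrow> int) \<Rightarrow> int \<Rightarrow> bool" where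
  "eq_solvable k l a b c \<longleftrightarrow> (\<exists>\<alpha>. exp_lhs k l a b \<alpha> = c)"

definition cong_solvable :: "nat \<Rightarrow> nat \<Rightarrow> (nat \<Rightarrow> int) \<Rightarrow> (nat \<Rightarrow> nat \<Rightarrow> int) \<Rightarrow> int \<Rightarrow> int \<Rightarrow> bool" where
  "cong_solvable k l a b c m \<longleftrightarrow> (\<exists>\<alpha>. [exp_lhs k l a b \<alpha> = c] (mod m))"

definition H0 :: "nat \<Rightarrow> nat \<Rightarrow> (nat \<Rightarrow> int) \<Rightarrow> (nat \<Rightarrow> nat \<Rightarrow> int) \<Rightarrow> int set" where
  "H0 k l a b = {c. \<not> eq_solvable k l a b c}"

definition H :: "nat \<Rightarrow> nat \<Rightarrow> (nat \<Rightarrow> int) \<Rightarrow> (nat \<Rightarrow> nat \<Rightarrow> int) \<Rightarrow> int set" where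
  "H k l a b = {c. \<not> eq_solvable k l a b c \<and> (\<forall>m::int. m \<ge> 2 \<longrightarrow> cong_solvable k l a b c m)}"

end

theory Submission
  imports Defs "HOL-Number_Theory.Number_Theory" "HOL-Computational_Algebra.Squarefree"
    "HOL-Library.Real_Mod"
begin

text \<open>
  It suffices to find, for every \<open>\<epsilon> > 0\<close>, a modulus \<open>m\<close> such that at most \<open>\<epsilon> m\<close> residues modulo \<open>m\<close>
  are attained by the left-hand side: both \<open>H\<close> and the complement of \<open>H\<^sub>0\<close> lie in the union of these
  residue classes, so \<open>H\<close> has density 0 and \<open>H\<^sub>0\<close> has density 1 in the integers.

  If \<open>m\<close> is a product of distinct primes \<open>p\<close> with \<open>p - 1\<close> dividing \<open>L\<close>, then every power of every
  integer is congruent modulo \<open>m\<close> to one with exponent at most \<open>L\<close>, so at most \<open>(L + 1)\<^sup>K\<close> residues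
  are attained, where \<open>K = k l\<close>. It remains to make the product of all these primes much
  larger than \<open>L\<^sup>K\<close>. Averaging over \<open>L = 3\<^sup>J n\<close> with \<open>n \<le> N\<close>, the mean of the sum of \<open>ln p\<close> over
  the primes with \<open>p - 1\<close> dividing \<open>L\<close> is, up to a bounded error, the sum over \<open>p \<le> N\<close> of
  \<open>gcd (3\<^sup>J, p - 1) ln p / p\<close>. Writing the gcd as the sum of \<open>\<phi>(3\<^sup>i)\<close> over \<open>i \<le> J\<close> with \<open>3\<^sup>i\<close> dividing
  \<open>p - 1\<close>, and using that the sum of \<open>ln p / p\<close> over \<open>p \<equiv> 1\<close> modulo \<open>3\<^sup>i\<close> is at least
  \<open>ln N / \<phi>(3\<^sup>i) - O(1)\<close>, this mean is at least \<open>(J + 1) ln N - O(1)\<close>; take \<open>J = K\<close>.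

  The estimate for primes congruent to 1 is Mertens' form of Dirichlet's theorem, proved by Shapiro's
  elementary method. Powers of 3 are chosen because their unit groups are cyclic and the only
  nonprincipal real character is the one modulo 3, whose value \<open>L(1, \<xi>) \<ge> 1/2\<close> is visible from the series.
\<close>

section \<open>Sums of arithmetic functions\<close>

text \<open>The pairs \<open>(n, d)\<close> with \<open>d\<close> dividing \<open>n\<close>
  correspond to the pairs \<open>(d, m)\<close> with \<open>d * m\<close> at most \<open>x\<close>,
  via \<open>n = d * m\<close>. Every Dirichlet convolution below is summed this way.\<close>

lemma sum_sum_dvd_swap:
  fixes F :: "nat \<Rightarrow> nat \<Rightarrow> 'a :: comm_monoid_add"
  shows "(\<Sum>n=1..x. \<Sum>d | d dvd n. F d (n div d)) = (\<Sum>d=1..x. \<Sum>m=1..x div d. F d m)"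
proof -
  have "(\<Sum>n=1..x. \<Sum>d | d dvd n. F d (n div d)) =
        (\<Sum>(n, d)\<in>(SIGMA n:{1..x}. {d. d dvd n}). F d (n div d))"
    by (subst sum.Sigma) auto
  also have "\<dots> = (\<Sum>(d, m)\<in>(SIGMA d:{1..x}. {1..x div d}). F d m)"
  proof (rule sum.reindex_bij_witness[where i = "\<lambda>(d, m). (d * m, d)" and j = "\<lambda>(n, d). (d, n div d)"], goal_cases)
    case (2 z)
    obtain n d where z: "z = (n, d)" by force
    with 2 have "1 \<le> n" "n \<le> x" "d dvd n" by auto
    hence "d > 0" "d \<le> n" by (auto intro!: Nat.gr0I dvd_imp_le)
    moreover from this have "n div d \<le> x div d" "n div d \<ge> 1"
      using \<open>n \<le> x\<close> \<open>1 \<le> n\<close> by (auto intro: div_le_mono simp: Suc_le_eq div_greater_zero_iff)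
    ultimately show ?case using \<open>n \<le> x\<close> by (simp add: z)
  next
    case (4 z)
    obtain d m where z: "z = (d, m)" by force
    with 4 have "1 \<le> d" "1 \<le> m" "m \<le> x div d" by auto
    thus ?case by (simp add: z less_eq_div_iff_mult_less_eq mult.commute)
  qed auto
  also have "\<dots> = (\<Sum>d=1..x. \<Sum>m=1..x div d. F d m)"
    by (subst sum.Sigma) auto
  finally show ?thesis .
qed

section \<open>Factorials, and the Chebyshev and Mertens bounds for the von Mangoldt
  function\<close>

lemma ln_fact_eq_sum_ln: "ln (fact n :: real) = (\<Sum>k=1..n. ln (real k))"
  unfolding fact_prod of_nat_prod by (rule ln_prod) auto

lemma ln_fact_eq_sum_mangoldt:
  "ln (fact x :: real) = (\<Sum>d=1..x. mangoldt d * real (x div d))"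
proof -
  have "ln (fact x :: real) = (\<Sum>n=1..x. \<Sum>d | d dvd n. mangoldt d)"
    unfolding ln_fact_eq_sum_ln by (intro sum.cong refl) (simp add: mangoldt_sum)
  also have "\<dots> = (\<Sum>d=1..x. \<Sum>m=1..x div d. mangoldt d)"
    by (rule sum_sum_dvd_swap)
  finally show ?thesis by (simp add: mult.commute)
qed

lemma ln_fact_ge: "ln (fact n :: real) \<ge> real n * ln (real n) - real n"
proof (induction n)
  case (Suc n)
  have "real n * (ln (real (Suc n)) - ln (real n)) \<le> 1"
  proof (cases "n = 0")
    case False
    have "ln (real (Suc n)) - ln (real n) = ln (1 + 1 / real n)"
      using False by (subst ln_divide_pos[symmetric]) (auto simp: field_simps)
    also have "\<dots> \<le> 1 / real n" by (rule ln_add_one_self_le_self) auto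
    finally show ?thesis using False by (simp add: field_simps)
  qed auto
  moreover have "ln (fact (Suc n) :: real) = ln (real (Suc n)) + ln (fact n)"
    by (simp add: ln_mult del: of_nat_Suc)
  ultimately show ?case using Suc.IH by (simp add: algebra_simps)
qed auto

lemma ln_fact_le: "ln (fact n :: real) \<le> real n * ln (real n)"
proof -
  have "ln (fact n :: real) \<le> (\<Sum>k=1..n. ln (real n))"
    unfolding ln_fact_eq_sum_ln by (intro sum_mono) auto
  thus ?thesis by simp
qed

text \<open>Chebyshev's argument: \<open>ln (2 * n choose n)\<close> is the sum of
  \<open>mangoldt d\<close> with weights \<open>2 * n div d - 2 * (n div d)\<close>. These are
  nonnegative and equal 1 for \<open>d\<close> between \<open>n + 1\<close> and
  \<open>2 * n\<close>, while the binomial coefficient is at most \<open>4 ^ n\<close>.\<close>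

lemma sum_mangoldt_double:
  "(\<Sum>d=1..2*n. mangoldt d :: real) \<le> (\<Sum>d=1..n. mangoldt d) + 2 * real n"
proof -
  let ?g = "\<lambda>d. real (2 * n div d) - 2 * real (n div d)"
  have nonneg: "?g d \<ge> 0" for d
  proof -
    have "2 * (n div d) \<le> 2 * n div d"
      by (cases "d = 0") (auto simp: less_eq_div_iff_mult_less_eq)
    thus ?thesis by linarith
  qed
  have "(\<Sum>d=n+1..2*n. mangoldt d :: real) = (\<Sum>d=n+1..2*n. mangoldt d * ?g d)"
  proof (intro sum.cong refl)
    fix d assume d: "d \<in> {n+1..2*n}"
    hence "n div d = 0" "2 * n div d = 1" by (auto intro: div_nat_eqI)
    thus "(mangoldt d :: real) = mangoldt d * ?g d" by simp
  qed
  also have "\<dots> \<le> (\<Sum>d=1..2*n. mangoldt d * ?g d)"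
    using nonneg by (intro sum_mono2) (auto intro!: mult_nonneg_nonneg mangoldt_nonneg)
  also have "\<dots> = (\<Sum>d=1..2*n. mangoldt d * real (2 * n div d)) - 2 * (\<Sum>d=1..2*n. mangoldt d * real (n div d))"
    by (simp add: algebra_simps sum_subtractf sum_distrib_left)
  also have "(\<Sum>d=1..2*n. mangoldt d * real (n div d)) = (\<Sum>d=1..n. mangoldt d * real (n div d))"
    by (intro sum.mono_neutral_right) auto
  also have "(\<Sum>d=1..2*n. mangoldt d * real (2 * n div d)) - 2 * (\<Sum>d=1..n. mangoldt d * real (n div d)) =
               ln (fact (2 * n)) - 2 * ln (fact n)"
    by (simp only: ln_fact_eq_sum_mangoldt)
  also have "\<dots> = ln (real (2 * n choose n))"
    by (simp add: binomial_fact ln_div ln_mult)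
  also have "\<dots> \<le> ln (2 ^ (2 * n))"
  proof -
    have "real (2 * n choose n) \<le> real (2 ^ (2 * n))"
      by (subst of_nat_le_iff) (rule binomial_le_pow2)
    moreover have "2 * n choose n > 0" by (rule zero_less_binomial) auto
    ultimately show ?thesis by (subst ln_le_cancel_iff) auto
  qed
  also have "\<dots> = 2 * real n * ln 2" by (simp add: ln_realpow)
  also have "\<dots> \<le> 2 * real n"
    using ln_2_less_1 by (simp add: mult_left_le)
  finally have "(\<Sum>d=n+1..2*n. mangoldt d :: real) \<le> 2 * real n" .
  moreover have "(\<Sum>d=1..2*n. mangoldt d :: real) = (\<Sum>d=1..n. mangoldt d) + (\<Sum>d=n+1..2*n. mangoldt d)"
    by (subst sum.union_disjoint[symmetric]) (auto intro!: sum.cong)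
  ultimately show ?thesis by simp
qed

text \<open>Induction by halving: with \<open>n = x div 2\<close> the doubling step gives
  \<open>4 * n + 2 * n\<close>, and the constant 4 leaves room for the last term when
  \<open>x\<close> is odd, which is at most \<open>ln (2 * n + 1) \<le> 2 * n\<close>.\<close>

lemma sum_mangoldt_le: "(\<Sum>d=1..x. mangoldt d :: real) \<le> 4 * real x"
proof (induction x rule: less_induct)
  case (less x)
  show ?case
  proof (cases "x = 0")
    case False
    define n where "n = x div 2"
    have IH: "(\<Sum>d=1..n. mangoldt d :: real) \<le> 4 * real n"
      using False by (intro less.IH) (auto simp: n_def)
    have x: "x = 2 * n \<or> x = Suc (2 * n)" by (auto simp: n_def)
    have "(mangoldt (Suc (2 * n)) :: real) \<le> ln (real (Suc (2 * n)))"
      by (intro mangoldt_le) auto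
    also have "\<dots> \<le> 2 * real n" by (rule ln_le_minus_one[THEN order.trans]) auto
    finally show ?thesis using x IH sum_mangoldt_double[of n] by auto
  qed auto
qed

lemma mertens_mangoldt_lower:
  assumes "x > 0"
  shows "(\<Sum>d=1..x. mangoldt d / real d) \<ge> ln (real x) - 1"
proof -
  have "real x * ln (real x) - real x \<le> ln (fact x)" by (rule ln_fact_ge)
  also have "\<dots> \<le> (\<Sum>d=1..x. mangoldt d * (real x / real d))"
    unfolding ln_fact_eq_sum_mangoldt
    by (intro sum_mono mult_left_mono mangoldt_nonneg) (rule of_nat_div_le_of_nat)
  also have "\<dots> = real x * (\<Sum>d=1..x. mangoldt d / real d)"
    by (simp add: sum_distrib_left mult_ac)
  finally have "real x * (ln (real x) - 1) \<le> real x * (\<Sum>d=1..x. mangoldt d / real d)"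
    by (simp add: algebra_simps)
  thus ?thesis using assms by (subst (asm) mult_le_cancel_left_pos) auto
qed

text \<open>Unlike in the lower bound, rounding now costs up to 1 per \<open>d\<close>; Chebyshev's
  bound limits the total cost to \<open>4 * x\<close>.\<close>

lemma mertens_mangoldt_upper:
  assumes "x > 0"
  shows "(\<Sum>d=1..x. mangoldt d / real d) \<le> ln (real x) + 4"
proof -
  have "real x * (\<Sum>d=1..x. mangoldt d / real d) = (\<Sum>d=1..x. mangoldt d * (real x / real d))"
    by (simp add: sum_distrib_left mult_ac)
  also have "\<dots> \<le> (\<Sum>d=1..x. mangoldt d * (real (x div d) + 1))"
  proof (intro sum_mono mult_left_mono mangoldt_nonneg)
    fix d assume "d \<in> {1..x}"
    have "real x = real d * real (x div d) + real (x mod d)"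
      by (metis mult_div_mod_eq of_nat_add of_nat_mult)
    moreover have "real (x mod d) \<le> real d" using \<open>d \<in> {1..x}\<close> by simp
    ultimately show "real x / real d \<le> real (x div d) + 1"
      using \<open>d \<in> {1..x}\<close> by (simp add: field_simps)
  qed
  also have "\<dots> = ln (fact x) + (\<Sum>d=1..x. mangoldt d)"
    unfolding ln_fact_eq_sum_mangoldt by (simp add: algebra_simps sum.distrib)
  also have "\<dots> \<le> real x * ln (real x) + 4 * real x"
    by (intro add_mono ln_fact_le sum_mangoldt_le)
  finally have "real x * (\<Sum>d=1..x. mangoldt d / real d) \<le> real x * (ln (real x) + 4)"
    by (simp add: algebra_simps)
  thus ?thesis using assms by (subst (asm) mult_le_cancel_left_pos) auto
qed

section \<open>The Moebius function and its divisor sums\<close>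

definition moebius_mu :: "nat \<Rightarrow> real" where
  "moebius_mu n = (if squarefree n then (-1) ^ card (prime_factors n) else 0)"

lemma abs_moebius_le: "\<bar>moebius_mu n\<bar> \<le> 1"
  by (simp add: moebius_mu_def)

lemma squarefree_prod_primes:
  assumes "finite P" "\<And>p. p \<in> P \<Longrightarrow> prime (p :: nat)"
  shows "squarefree (\<Prod>P)"
  using assms by (intro squarefree_prod_coprime) (auto intro: primes_coprime squarefree_prime)

lemma prime_factors_prod_primes:
  assumes "finite P" "\<And>p. p \<in> P \<Longrightarrow> prime (p :: nat)"
  shows "prime_factors (\<Prod>P) = P"
  using assms
proof (induction P rule: finite_induct)
  case (insert p P)
  have "\<Prod>P \<noteq> 0" using insert.prems insert.hyps by (metis insertCI not_prime_0 prod_zero_iff)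
  moreover have "p \<noteq> 0" using insert.prems[of p] by (auto intro!: Nat.gr0I)
  ultimately have "prime_factors (p * \<Prod>P) = prime_factors p \<union> prime_factors (\<Prod>P)"
    by (intro prime_factors_product) auto
  also have "prime_factors (\<Prod>P) = P" using insert by auto
  also have "prime_factors p = {p}" using insert.prems[of p] by (simp add: prime_prime_factors)
  finally show ?case using insert.hyps by simp
qed auto

lemma prod_prime_factors_squarefree:
  assumes "squarefree (n :: nat)"
  shows "\<Prod>(prime_factors n) = n"
proof -
  have "n \<noteq> 0" using assms by (auto intro!: Nat.gr0I)
  hence "n = (\<Prod>p\<in>prime_factors n. p ^ multiplicity p n)"
    by (simp add: prime_factorization_nat)
  also have "\<dots> = \<Prod>(prime_factors n)"
    using assms \<open>n \<noteq> 0\<close>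
    by (intro prod.cong refl) (metis in_prime_factors_iff le_antisym less_one not_le power_one_right prime_factors_multiplicity
          squarefree_factorial_semiring'' mem_Collect_eq One_nat_def Suc_leI)
  finally show ?thesis by simp
qed

text \<open>Squarefree divisors correspond to subsets of the set of prime factors, and the signed
  sum over all subsets factors into a product of terms \<open>-1 + 1\<close>.\<close>

lemma sum_moebius:
  assumes "n > 0"
  shows "(\<Sum>d | d dvd n. moebius_mu d) = (if n = 1 then 1 else 0)"
proof -
  let ?P = "prime_factors n"
  have "(\<Sum>d | d dvd n. moebius_mu d) = (\<Sum>d | d dvd n \<and> squarefree d. (-1) ^ card (prime_factors d))"
    using assms by (intro sum.mono_neutral_cong_right) (auto simp: moebius_mu_def)
  also have "\<dots> = (\<Sum>S\<in>Pow ?P. (-1) ^ card S)"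
  proof (rule sum.reindex_bij_witness[where i = "\<lambda>S. \<Prod>S" and j = prime_factors])
    fix S assume S: "S \<in> Pow ?P"
    hence fin: "finite S" and pr: "\<And>p. p \<in> S \<Longrightarrow> prime p" by (auto intro: finite_subset)
    show "prime_factors (\<Prod>S) = S" by (rule prime_factors_prod_primes) fact+
    have "\<Prod>S dvd n"
    proof -
      have "\<Prod>S dvd \<Prod>?P" using S by (intro prod_dvd_prod_subset) auto
      also have "\<dots> dvd (\<Prod>p\<in>?P. p ^ multiplicity p n)"
        by (intro prod_dvd_prod dvd_power) (auto simp: prime_factors_multiplicity)
      also have "\<dots> = n" using assms by (simp add: prime_factorization_nat[symmetric])
      finally show ?thesis .
    qed
    thus "\<Prod>S \<in> {d. d dvd n \<and> squarefree d}"
      using squarefree_prod_primes[OF fin pr] by simp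
  qed (use assms in \<open>auto simp: prod_prime_factors_squarefree intro: dvd_prime_factors[THEN subsetD, rotated]\<close>)
  also have "\<dots> = (\<Prod>p\<in>?P. -1 + (1 :: real))"
    by (subst prod_add) auto
  also have "\<dots> = (if n = 1 then 1 else 0)"
    using assms by (auto simp: prime_factorization_empty_iff card_gt_0_iff)
  finally show ?thesis .
qed

text \<open>Expand \<open>ln (n / d)\<close> as a sum of \<open>mangoldt e\<close> and exchange the
  sums: the inner Moebius sum survives only for \<open>e = n\<close>. The term with
  \<open>ln n\<close> vanishes for every \<open>n\<close>, as \<open>ln 1 = 0\<close>.\<close>

lemma sum_moebius_ln:
  assumes "n > 0"
  shows "(\<Sum>d | d dvd n. moebius_mu d * ln (real d)) = - mangoldt n"
proof -
  have "(\<Sum>d | d dvd n. moebius_mu d * ln (real n)) - (\<Sum>d | d dvd n. moebius_mu d * ln (real d)) =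
        (\<Sum>d | d dvd n. moebius_mu d * ln (real (n div d)))"
    unfolding sum_subtractf[symmetric]
  proof (intro sum.cong refl)
    fix d assume "d \<in> {d. d dvd n}"
    then obtain e where "n = d * e" by auto
    with assms show "moebius_mu d * ln (real n) - moebius_mu d * ln (real d) = moebius_mu d * ln (real (n div d))"
      by (simp add: ln_mult algebra_simps)
  qed
  also have "\<dots> = (\<Sum>d | d dvd n. \<Sum>e | e dvd n div d. moebius_mu d * mangoldt e)"
    using assms by (intro sum.cong refl) (auto simp: mangoldt_sum sum_distrib_left[symmetric] elim!: dvdE)
  also have "\<dots> = (\<Sum>(d, e)\<in>(SIGMA d:{d. d dvd n}. {e. e dvd n div d}). moebius_mu d * mangoldt e)"
    using assms by (subst sum.Sigma) (auto elim!: dvdE)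
  also have "\<dots> = (\<Sum>(e, d)\<in>(SIGMA e:{e. e dvd n}. {d. d dvd n div e}). moebius_mu d * mangoldt e)"
    using assms by (intro sum.reindex_bij_witness[where i = "\<lambda>(x, y). (y, x)" and j = "\<lambda>(x, y). (y, x)"])
      (auto elim!: dvdE)
  also have "\<dots> = (\<Sum>e | e dvd n. \<Sum>d | d dvd n div e. moebius_mu d * mangoldt e)"
    using assms by (subst sum.Sigma) (auto elim!: dvdE)
  also have "\<dots> = (\<Sum>e | e dvd n. mangoldt e * (if e = n then 1 else 0))"
  proof (intro sum.cong refl)
    fix e assume "e \<in> {e. e dvd n}"
    then obtain f where "n = e * f" by auto
    with assms show "(\<Sum>d | d dvd n div e. moebius_mu d * mangoldt e) = mangoldt e * (if e = n then 1 else 0)"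
      by (auto simp: sum_moebius sum_distrib_right[symmetric])
  qed
  also have "\<dots> = mangoldt n"
    using assms by (subst sum.remove[of _ n]) (auto intro!: sum.neutral)
  finally show ?thesis
    using assms by (simp add: sum_moebius sum_distrib_right[symmetric] split: if_splits)
qed

section \<open>Multiplicative functions with bounded partial sums\<close>

text \<open>Abel summation: the partial sums are at most \<open>B\<close> in norm and the weights
  \<open>f n - f (Suc n)\<close> are nonnegative, so the bounds telescope.\<close>

lemma norm_sum_antimono_le:
  fixes c :: "nat \<Rightarrow> complex" and f :: "nat \<Rightarrow> real"
  assumes c: "\<And>n. norm (\<Sum>i\<in>{m<..n}. c i) \<le> B"
    and f_mono: "\<And>n. n > m \<Longrightarrow> f (Suc n) \<le> f n" and f_nonneg: "\<And>n. n > m \<Longrightarrow> f n \<ge> 0"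
  shows "norm (\<Sum>n\<in>{m<..N}. c n * of_real (f n)) \<le> B * f (Suc m)"
proof (cases "m \<le> N")
  case True
  define S where "S n = (\<Sum>i\<in>{m<..n}. c i)" for n
  have S_Suc: "{m<..Suc n} = insert (Suc n) {m<..n}" if "n \<ge> m" for n
    using that by auto
  have tele: "(\<Sum>n\<in>{m<..N}. c n * of_real (f n)) =
               S N * of_real (f (Suc N)) + (\<Sum>n\<in>{m<..N}. S n * of_real (f n - f (Suc n)))"
    using True
  proof (induction N rule: dec_induct)
    case base
    show ?case by (simp add: S_def)
  next
    case (step N)
    have "S (Suc N) = c (Suc N) + S N" using step.hyps by (simp add: S_def S_Suc)
    thus ?case using step by (simp add: S_Suc algebra_simps)
  qed
  have tele2: "(\<Sum>n\<in>{m<..N}. f n - f (Suc n)) = f (Suc m) - f (Suc N)"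
    using True by (induction N rule: dec_induct) (auto simp: S_Suc)
  have "norm (\<Sum>n\<in>{m<..N}. c n * of_real (f n)) \<le>
          norm (S N * of_real (f (Suc N))) + (\<Sum>n\<in>{m<..N}. norm (S n * of_real (f n - f (Suc n))))"
    unfolding tele by (intro norm_triangle_le add_left_mono norm_sum)
  also have "\<dots> \<le> B * f (Suc N) + (\<Sum>n\<in>{m<..N}. B * (f n - f (Suc n)))"
  proof (intro add_mono sum_mono)
    show "norm (S N * of_real (f (Suc N))) \<le> B * f (Suc N)"
      using c[of N] f_nonneg[of "Suc N"] True by (auto simp: norm_mult S_def intro!: mult_right_mono)
  next
    fix n assume "n \<in> {m<..N}"
    thus "norm (S n * of_real (f n - f (Suc n))) \<le> B * (f n - f (Suc n))"
      using c[of n] f_mono[of n] unfolding norm_mult norm_of_real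
      by (auto simp: S_def intro!: mult_right_mono)
  qed
  also have "\<dots> = B * f (Suc m)"
    unfolding sum_distrib_left[symmetric] tele2 by (simp add: algebra_simps)
  finally show ?thesis .
next
  case False
  have "0 \<le> B" using c[of 0] norm_ge_zero order.trans by blast
  thus ?thesis using False f_nonneg[of "Suc m"] by auto
qed

text \<open>The threshold 3 is the first integer beyond \<open>exp 1\<close>, where
  \<open>ln t / t\<close> starts to decrease.\<close>

lemma ln_div_self_antimono:
  assumes "n \<ge> 3"
  shows "ln (real (Suc n)) / real (Suc n) \<le> ln (real n) / real n"
proof -
  have "exp 1 \<le> real n" using exp_le assms by linarith
  hence "1 \<le> ln (real n)" using assms by (subst ln_ge_iff) auto
  have "ln (real (Suc n)) - ln (real n) = ln (1 + 1 / real n)"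
    using assms by (subst ln_divide_pos[symmetric]) (auto simp: field_simps)
  also have "\<dots> \<le> 1 / real n" by (rule ln_add_one_self_le_self) auto
  finally have "real n * (ln (real (Suc n)) - ln (real n)) \<le> ln (real n)"
    using \<open>1 \<le> ln (real n)\<close> assms by (simp add: field_simps)
  thus ?thesis using assms by (simp add: field_simps)
qed

text \<open>An abstract nonprincipal Dirichlet character: complete multiplicativity and uniformly
  bounded interval sums are what Shapiro's method uses.\<close>

locale bounded_multiplicative =
  fixes \<xi> :: "nat \<Rightarrow> complex" and B :: real
  assumes one: "\<xi> 1 = 1"
    and mult: "\<And>m n. \<xi> (m * n) = \<xi> m * \<xi> n"
    and norm_le: "\<And>n. norm (\<xi> n) \<le> 1"
    and sum_bounded: "\<And>m n. norm (\<Sum>i\<in>{m<..n}. \<xi> i) \<le> B"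
begin

lemma B_nonneg: "B \<ge> 0"
  using sum_bounded[of 0 0] by simp

text \<open>Partial sums of the series for \<open>L(1, \<xi>)\<close>.\<close>

definition T :: "nat \<Rightarrow> complex" where
  "T x = (\<Sum>n=1..x. \<xi> n / of_nat n)"

text \<open>Partial sums of the series that formally represents \<open>-L'/L\<close> at 1.\<close>

definition A :: "nat \<Rightarrow> complex" where
  "A x = (\<Sum>n=1..x. \<xi> n * mangoldt n / of_nat n)"

lemma T_diff_le:
  assumes "m \<le> N"
  shows "norm (T N - T m) \<le> B / real (Suc m)"
proof -
  have "T N = T m + (\<Sum>n\<in>{m<..N}. \<xi> n / of_nat n)"
    unfolding T_def using assms
    by (subst sum.union_disjoint[symmetric]) (auto intro!: sum.cong)
  hence "norm (T N - T m) = norm (\<Sum>n\<in>{m<..N}. \<xi> n * of_real (1 / real n))"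
    by simp
  also have "\<dots> \<le> B * (1 / real (Suc m))"
    by (rule norm_sum_antimono_le[OF sum_bounded]) (auto simp: field_simps)
  finally show ?thesis by simp
qed

lemma T_convergent: "convergent T"
proof -
  have "Cauchy T"
  proof (rule metric_CauchyI)
    fix e :: real assume "e > 0"
    obtain M :: nat where M: "B / e < real M" using reals_Archimedean2 by blast
    show "\<exists>M. \<forall>m\<ge>M. \<forall>n\<ge>M. dist (T m) (T n) < e"
    proof (intro exI allI impI)
      fix m n assume mn: "m \<ge> M" "n \<ge> M"
      have *: "norm (T n - T m) < e" if "m \<ge> M" "m \<le> n" for m n
      proof -
        have "norm (T n - T m) \<le> B / real (Suc m)" by (rule T_diff_le) fact
        also have "\<dots> < e"
        proof -
          have "B / e < real (Suc m)" using M that by linarith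
          thus ?thesis using \<open>e > 0\<close> by (simp add: field_simps)
        qed
        finally show ?thesis .
      qed
      show "dist (T m) (T n) < e"
        using *[of m n] *[of n m] mn by (cases "m \<le> n") (auto simp: dist_norm norm_minus_commute)
    qed
  qed
  thus ?thesis by (rule Cauchy_convergent)
qed

definition L :: complex where "L = lim T"

lemma T_tendsto: "T \<longlonglongrightarrow> L"
  using T_convergent unfolding L_def convergent_LIMSEQ_iff .

lemma T_minus_L_le: "norm (T m - L) \<le> B / real (Suc m)"
proof -
  have "(\<lambda>N. norm (T N - T m)) \<longlonglongrightarrow> norm (L - T m)"
    by (intro tendsto_intros T_tendsto)
  moreover have "eventually (\<lambda>N. norm (T N - T m) \<le> B / real (Suc m)) sequentially"
    using eventually_ge_at_top[of m] by eventually_elim (rule T_diff_le)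
  ultimately have "norm (L - T m) \<le> B / real (Suc m)"
    by (rule tendsto_upperbound) auto
  thus ?thesis by (simp add: norm_minus_commute)
qed

text \<open>The error grows linearly in \<open>d\<close>, which cancels the weight
  \<open>1 / d\<close> in the convolutions below.\<close>

lemma T_div_minus_L_le:
  assumes "d \<in> {1..x}"
  shows "norm (T (x div d) - L) \<le> B * real d / real x"
proof -
  have "norm (T (x div d) - L) \<le> B / real (Suc (x div d))" by (rule T_minus_L_le)
  also have "\<dots> \<le> B / (real x / real d)"
  proof (intro divide_left_mono)
    have "x < d * Suc (x div d)"
      using assms by (simp add: dividend_less_times_div)
    hence "real x < real d * real (Suc (x div d))" by (metis of_nat_less_iff of_nat_mult)
    thus "real x / real d \<le> real (Suc (x div d))" using assms by (simp add: field_simps)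
  qed (use assms B_nonneg in auto)
  finally show ?thesis by simp
qed

lemma sum_ln_bounded: "norm (\<Sum>n=1..x. \<xi> n * of_real (ln (real n) / real n)) \<le> 3 + B"
proof -
  let ?f = "\<lambda>n. \<xi> n * of_real (ln (real n) / real n)"
  have small: "norm (?f n) \<le> 1" if "n \<in> {1..2}" for n
  proof -
    have "ln (real n) \<le> real n" using that by (intro order.trans[OF ln_le_minus_one]) auto
    hence "ln (real n) / real n \<le> 1" using that by (simp add: field_simps)
    moreover have "ln (real n) / real n \<ge> 0" using that by auto
    ultimately show ?thesis unfolding norm_mult norm_of_real using norm_le[of n]
      by (intro mult_le_one) linarith+
  qed
  \<comment> \<open>Abel summation applies only from 3 on, where the weights decrease;
    \<open>min x 2\<close> also covers \<open>x < 2\<close>.\<close>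
  have "norm (\<Sum>n=1..x. ?f n) = norm ((\<Sum>n=1..min x 2. ?f n) + (\<Sum>n\<in>{2<..x}. ?f n))"
    by (subst sum.union_disjoint[symmetric]) (auto intro!: arg_cong[of _ _ norm] sum.cong)
  also have "\<dots> \<le> (\<Sum>n=1..min x 2. norm (?f n)) + norm (\<Sum>n\<in>{2<..x}. ?f n)"
    by (intro norm_triangle_le add_right_mono norm_sum)
  also have "(\<Sum>n=1..min x 2. norm (?f n)) \<le> (\<Sum>n=1..min x 2. 1)"
    using small by (intro sum_mono) auto
  also have "\<dots> \<le> 2" by simp
  also have "norm (\<Sum>n\<in>{2<..x}. ?f n) \<le> B * (ln (real (Suc 2)) / real (Suc 2))"
    using ln_div_self_antimono
    by (intro norm_sum_antimono_le sum_bounded) (auto simp del: of_nat_Suc)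
  also have "\<dots> \<le> B * 1"
    using ln_le_minus_one[of 3] B_nonneg by (intro mult_left_mono) auto
  finally show ?thesis by simp
qed

text \<open>Since \<open>ln\<close> is the divisor sum of \<open>mangoldt\<close>, the bounded sum
  of \<open>\<xi> n * ln n / n\<close> is the sum of
  \<open>\<xi> d * mangoldt d / d * T (x div d)\<close>. Replacing \<open>T\<close> by its limit
  costs at most \<open>4 * B\<close> by Chebyshev's bound, so \<open>A x * L\<close> is bounded and
  \<open>L\<close> can be divided out.\<close>

lemma A_bounded:
  assumes "L \<noteq> 0"
  shows "norm (A x) \<le> (3 + 5 * B) / norm L"
proof (cases "x = 0")
  case True
  thus ?thesis using B_nonneg by (simp add: A_def)
next
  case False
  have "(\<Sum>n=1..x. \<xi> n * of_real (ln (real n) / real n)) =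
        (\<Sum>n=1..x. \<Sum>d | d dvd n. (\<xi> d * mangoldt d / of_nat d) * (\<xi> (n div d) / of_nat (n div d)))"
  proof (intro sum.cong refl)
    fix n assume n: "n \<in> {1..x}"
    have "\<xi> n * of_real (ln (real n) / real n) = (\<Sum>d | d dvd n. \<xi> n / of_nat n * mangoldt d)"
      using n mangoldt_sum[of n, where 'a = complex] unfolding sum_distrib_left[symmetric] by simp
    also have "\<dots> = (\<Sum>d | d dvd n. (\<xi> d * mangoldt d / of_nat d) * (\<xi> (n div d) / of_nat (n div d)))"
      using n by (intro sum.cong refl) (auto elim!: dvdE simp: mult)
    finally show "\<xi> n * of_real (ln (real n) / real n) = \<dots>" .
  qed
  also have "\<dots> = (\<Sum>d=1..x. \<xi> d * mangoldt d / of_nat d * T (x div d))"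
    by (subst sum_sum_dvd_swap) (simp add: T_def sum_distrib_left)
  also have "\<dots> = A x * L + (\<Sum>d=1..x. \<xi> d * mangoldt d / of_nat d * (T (x div d) - L))"
    unfolding A_def sum_distrib_right sum.distrib[symmetric]
    by (intro sum.cong refl) (simp only: distrib_left[symmetric] add_diff_eq add_diff_cancel_left')
  finally have eq: "A x * L = (\<Sum>n=1..x. \<xi> n * of_real (ln (real n) / real n)) -
     (\<Sum>d=1..x. \<xi> d * mangoldt d / of_nat d * (T (x div d) - L))" by simp
  have "norm (\<Sum>d=1..x. \<xi> d * mangoldt d / of_nat d * (T (x div d) - L)) \<le>
          (\<Sum>d=1..x. mangoldt d / real d * (B * real d / real x))"
  proof (intro order.trans[OF norm_sum] sum_mono)
    fix d assume d: "d \<in> {1..x}"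
    have "norm (\<xi> d * mangoldt d / of_nat d * (T (x div d) - L)) =
          norm (\<xi> d) * (mangoldt d / real d) * norm (T (x div d) - L)"
      by (simp add: norm_mult norm_divide)
    also have "\<dots> \<le> 1 * (mangoldt d / real d) * (B * real d / real x)"
      using B_nonneg norm_le[of d] T_div_minus_L_le[OF d]
      by (intro mult_mono mult_right_mono) (auto intro!: divide_nonneg_nonneg mangoldt_nonneg mult_nonneg_nonneg)
    finally show "norm (\<xi> d * mangoldt d / of_nat d * (T (x div d) - L)) \<le> mangoldt d / real d * (B * real d / real x)"
      by simp
  qed
  also have "\<dots> = B / real x * (\<Sum>d=1..x. mangoldt d)"
    unfolding sum_distrib_left by (intro sum.cong) auto
  also have "\<dots> \<le> B / real x * (4 * real x)"
    using B_nonneg by (intro mult_left_mono sum_mangoldt_le) auto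
  also have "\<dots> = 4 * B" using False by simp
  finally have "norm (A x * L) \<le> (3 + B) + 4 * B"
    unfolding eq by (intro order.trans[OF norm_triangle_ineq4] add_mono sum_ln_bounded)
  thus ?thesis using assms by (simp add: norm_mult field_simps)
qed

text \<open>The weights \<open>moebius_mu d * ln (x / d)\<close> have divisor sum
  \<open>mangoldt n\<close>, plus \<open>ln x\<close> at \<open>n = 1\<close>. Convolving them with
  \<open>\<xi>\<close> brings in \<open>T (x div d)\<close>, which is itself only of order
  \<open>d / x\<close> when \<open>L = 0\<close>.\<close>

lemma A_plus_ln_bounded:
  assumes "L = 0" "x > 0"
  shows "norm (A x + of_real (ln (real x))) \<le> B"
proof -
  let ?m = "\<lambda>d. moebius_mu d * ln (real x / real d)"
  have "A x + of_real (ln (real x)) =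
          (\<Sum>n=1..x. \<xi> n / of_nat n * of_real (mangoldt n + (if n = 1 then ln (real x) else 0)))"
  proof -
    have "(\<Sum>n=1..x. \<xi> n / of_nat n * of_real (mangoldt n + (if n = 1 then ln (real x) else 0))) =
            A x + (\<Sum>n=1..x. \<xi> n / of_nat n * of_real (if n = 1 then ln (real x) else 0))"
      unfolding A_def sum.distrib[symmetric] by (intro sum.cong refl) (simp add: distrib_left)
    also have "(\<Sum>n=1..x. \<xi> n / of_nat n * of_real (if n = 1 then ln (real x) else 0)) =
            (\<Sum>n\<in>{1}. \<xi> n / of_nat n * of_real (ln (real x)))"
      using assms by (intro sum.mono_neutral_cong_right) auto
    finally show ?thesis using one by simp
  qed
  also have "\<dots> = (\<Sum>n=1..x. \<Sum>d | d dvd n. \<xi> n / of_nat n * of_real (?m d))"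
  proof (intro sum.cong refl)
    fix n assume n: "n \<in> {1..x}"
    have "(\<Sum>d | d dvd n. ?m d) = (\<Sum>d | d dvd n. ln (real x) * moebius_mu d - moebius_mu d * ln (real d))"
      using assms n by (intro sum.cong refl) (auto simp: ln_div algebra_simps intro!: Nat.gr0I)
    also have "\<dots> = ln (real x) * (if n = 1 then 1 else 0) + mangoldt n"
      using n sum_moebius[of n] sum_moebius_ln[of n] by (simp add: sum_subtractf sum_distrib_left[symmetric])
    finally show "\<xi> n / of_nat n * of_real (mangoldt n + (if n = 1 then ln (real x) else 0)) =
       (\<Sum>d | d dvd n. \<xi> n / of_nat n * of_real (?m d))"
      unfolding sum_distrib_left[symmetric] of_real_sum[symmetric] by simp
  qed
  also have "\<dots> = (\<Sum>n=1..x. \<Sum>d | d dvd n. (\<xi> d * of_real (?m d) / of_nat d) * (\<xi> (n div d) / of_nat (n div d)))"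
    by (intro sum.cong refl) (auto elim!: dvdE simp: mult)
  also have "\<dots> = (\<Sum>d=1..x. \<xi> d * of_real (?m d) / of_nat d * T (x div d))"
    by (subst sum_sum_dvd_swap) (simp add: T_def sum_distrib_left)
  finally have "norm (A x + of_real (ln (real x))) = norm (\<Sum>d=1..x. \<xi> d * of_real (?m d) / of_nat d * T (x div d))"
    by simp
  also have "\<dots> \<le> (\<Sum>d=1..x. B / real x * ln (real x / real d))"
  proof (intro order.trans[OF norm_sum] sum_mono)
    fix d assume d: "d \<in> {1..x}"
    have pos: "ln (real x / real d) \<ge> 0" using d by (intro ln_ge_zero) auto
    have "norm (\<xi> d * of_real (?m d) / of_nat d * T (x div d)) =
          norm (\<xi> d) * (\<bar>moebius_mu d\<bar> * ln (real x / real d) / real d) * norm (T (x div d))"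
      using pos by (simp add: norm_mult norm_divide abs_mult)
    also have "\<dots> \<le> 1 * (1 * ln (real x / real d) / real d) * (B * real d / real x)"
      using B_nonneg norm_le[of d] T_div_minus_L_le[OF d] pos assms abs_moebius_le[of d]
      by (intro mult_mono mult_right_mono divide_right_mono) auto
    finally show "norm (\<xi> d * of_real (?m d) / of_nat d * T (x div d)) \<le> B / real x * ln (real x / real d)"
      using d by (simp add: field_simps)
  qed
  also have "\<dots> = B / real x * (\<Sum>d=1..x. ln (real x) - ln (real d))"
    unfolding sum_distrib_left using assms by (intro sum.cong) (auto simp: ln_div)
  \<comment> \<open>The sum of \<open>ln (x / d)\<close> is at most \<open>x\<close> by the
    Stirling-type lower bound on \<open>ln (fact x)\<close>.\<close>
  also have "(\<Sum>d=1..x. ln (real x) - ln (real d)) = real x * ln (real x) - ln (fact x)"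
    by (simp add: sum_subtractf ln_fact_eq_sum_ln)
  also have "B / real x * \<dots> \<le> B / real x * real x"
    using ln_fact_ge[of x] B_nonneg by (intro mult_left_mono) auto
  finally show ?thesis using assms by simp
qed

text \<open>A one-sided bound that holds whether or not \<open>L\<close> vanishes; it controls the
  remaining characters in the nonvanishing argument.\<close>

lemma Re_A_bounded_above: "\<exists>C. \<forall>x>0. Re (A x) \<le> C"
proof (cases "L = 0")
  case True
  have "Re (A x) \<le> B" if "x > 0" for x
  proof -
    have "Re (A x + of_real (ln (real x))) \<le> B"
      using A_plus_ln_bounded[OF True that] complex_Re_le_cmod order.trans by blast
    moreover have "ln (real x) \<ge> 0" using that by simp
    ultimately show ?thesis by simp
  qed
  thus ?thesis by blast
next
  case False
  thus ?thesis using A_bounded complex_Re_le_cmod order.trans by blast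
qed

end

section \<open>Characters from a primitive root\<close>

lemma sum_roots_of_unity:
  assumes "n > 0" "\<not> n dvd a"
  shows "(\<Sum>i<n. cis (2 * pi * real a * real i / real n)) = 0"
proof -
  define z where "z = cis (2 * pi * real a / real n)"
  have "z ^ n = cis (real n * (2 * pi * real a / real n))" unfolding z_def by (rule Complex.DeMoivre)
  also have "\<dots> = cis (2 * pi * real a)" using assms by simp
  also have "\<dots> = 1" by (rule cis_multiple_2pi) auto
  finally have zn: "z ^ n = 1" .
  have "z \<noteq> 1"
  proof
    assume "z = 1"
    then obtain k :: int where "2 * pi * real a / real n = of_int k * (2 * pi)"
      by (auto simp: z_def cis_eq_1_iff)
    hence "real a = of_int k * real n" using assms by (simp add: field_simps)
    hence "of_int (int a) = (of_int (k * int n) :: real)" by simp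
    hence "int a = k * int n" by (subst (asm) of_int_eq_iff)
    hence "int n dvd int a" by simp
    thus False using assms by simp
  qed
  hence "0 = (\<Sum>i<n. z ^ i)" using zn by (simp add: geometric_sum)
  also have "(\<Sum>i<n. z ^ i) = (\<Sum>i<n. cis (2 * pi * real a * real i / real n))"
    unfolding z_def Complex.DeMoivre by (intro sum.cong refl arg_cong[of _ _ cis]) simp
  finally show ?thesis by (rule sym)
qed

text \<open>The discrete logarithm takes a junk value on residues that are not coprime to \<open>M\<close>.\<close>

definition dlog :: "nat \<Rightarrow> nat \<Rightarrow> nat \<Rightarrow> nat" where
  "dlog M g n = inv_into {..<totient M} (\<lambda>i. g ^ i mod M) (n mod M)"

text \<open>The character modulo \<open>M\<close> sending the primitive root \<open>g\<close> to
  \<open>exp (2 pi i a / totient M)\<close>. As the units are cyclic, \<open>a < totient M\<close>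
  yields all characters; the coprimality test hides the junk logarithms.\<close>

definition dchar :: "nat \<Rightarrow> nat \<Rightarrow> nat \<Rightarrow> nat \<Rightarrow> complex" where
  "dchar M g a n = (if coprime n M then cis (2 * pi * real a * real (dlog M g n) / real (totient M)) else 0)"

lemma cis_cong_mod:
  assumes "[i = j] (mod n)" "n > 0"
  shows "cis (2 * pi * real a * real i / real n) = cis (2 * pi * real a * real j / real n)"
proof -
  have *: "cis (2 * pi * real a * real i / real n) = cis (2 * pi * real a * real (i mod n) / real n)" for i
  proof -
    have "real i = real n * real (i div n) + real (i mod n)"
      by (metis mult_div_mod_eq of_nat_add of_nat_mult)
    hence "2 * pi * real a * real i / real n =
            2 * pi * real (a * (i div n)) + 2 * pi * real a * real (i mod n) / real n"
      using assms by (simp add: field_simps)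
    also have "cis \<dots> = cis (2 * pi * real a * real (i mod n) / real n)"
      by (simp add: cis_mult[symmetric] del: of_nat_mult)
    finally show ?thesis .
  qed
  show ?thesis using *[of i] *[of j] assms(1) by (simp add: cong_def)
qed

locale primroot_modulus =
  fixes M g :: nat
  assumes M: "M > 1" and g: "residue_primroot M g"
begin

abbreviation "\<phi> \<equiv> totient M"

lemma phi_pos: "\<phi> > 0"
  using M by simp

lemma bij: "bij_betw (\<lambda>i. g ^ i mod M) {..<\<phi>} (totatives M)"
  by (rule residue_primroot_is_generator[OF M g])

lemma mod_in_totatives: "coprime n M \<Longrightarrow> n mod M \<in> totatives M"
  using M by (auto simp: totatives_def coprime_commute intro!: Nat.gr0I)

lemma dlog_less: "coprime n M \<Longrightarrow> dlog M g n < \<phi>"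
  and power_dlog: "coprime n M \<Longrightarrow> [g ^ dlog M g n = n] (mod M)"
proof -
  assume "coprime n M"
  hence *: "n mod M \<in> (\<lambda>i. g ^ i mod M) ` {..<\<phi>}"
    using bij mod_in_totatives[of n] by (simp add: bij_betw_def)
  show "dlog M g n < \<phi>" using inv_into_into[OF *] by (simp add: dlog_def)
  show "[g ^ dlog M g n = n] (mod M)"
    using f_inv_into_f[OF *] by (simp add: dlog_def cong_def)
qed

lemma coprime_g: "coprime M g" and ord_g: "ord M g = \<phi>"
  using g by (auto simp: residue_primroot_def)

text \<open>Powers of \<open>g\<close> agree modulo \<open>M\<close> exactly when their exponents
  agree modulo the order of \<open>g\<close>, which is \<open>\<phi>\<close>. The laws of
  \<open>dlog\<close> all follow from this.\<close>

lemma dlog_cong_iff: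
  assumes "coprime n M"
  shows "[dlog M g n = i] (mod \<phi>) \<longleftrightarrow> [n = g ^ i] (mod M)"
proof -
  have "[n = g ^ i] (mod M) \<longleftrightarrow> [g ^ dlog M g n = g ^ i] (mod M)"
    using power_dlog[OF assms] by (simp add: cong_def)
  also have "\<dots> \<longleftrightarrow> [dlog M g n = i] (mod \<phi>)"
    using order_divides_expdiff[OF coprime_g] ord_g by simp
  finally show ?thesis ..
qed

lemma dlog_mult:
  assumes "coprime m M" "coprime n M"
  shows "[dlog M g (m * n) = dlog M g m + dlog M g n] (mod \<phi>)"
proof (subst dlog_cong_iff)
  show "coprime (m * n) M" using assms by simp
  show "[m * n = g ^ (dlog M g m + dlog M g n)] (mod M)"
    unfolding power_add by (intro cong_mult cong_sym[OF power_dlog] assms)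
qed

lemma dlog_1: "dlog M g 1 = 0"
proof -
  have "[dlog M g 1 = 0] (mod \<phi>)" by (subst dlog_cong_iff) auto
  thus ?thesis using dlog_less[of 1] by (simp add: cong_def)
qed

lemma dchar_one: "dchar M g a 1 = 1"
  using dlog_1 by (simp add: dchar_def)

lemma dchar_mult: "dchar M g a (m * n) = dchar M g a m * dchar M g a n"
proof (cases "coprime m M \<and> coprime n M")
  case True
  hence "dchar M g a (m * n) = cis (2 * pi * real a * real (dlog M g m + dlog M g n) / real \<phi>)"
    using cis_cong_mod[OF dlog_mult phi_pos, of m n a] by (simp add: dchar_def)
  also have "\<dots> = dchar M g a m * dchar M g a n"
    using True by (simp add: dchar_def cis_mult ring_distribs add_divide_distrib)
  finally show ?thesis .
qed (auto simp: dchar_def)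

lemma norm_dchar_le: "norm (dchar M g a n) \<le> 1"
  by (simp add: dchar_def)

lemma dchar_mod: "dchar M g a (n mod M) = dchar M g a n"
proof -
  have "coprime (n mod M) M \<longleftrightarrow> coprime n M"
    using M by (intro coprime_mod_left_iff) simp
  thus ?thesis by (simp add: dchar_def dlog_def)
qed

lemma sum_dchar_period:
  assumes "\<not> \<phi> dvd a"
  shows "(\<Sum>n<M. dchar M g a n) = 0"
proof -
  have "(\<Sum>n<M. dchar M g a n) = (\<Sum>n\<in>totatives M. dchar M g a n)"
  proof (intro sum.mono_neutral_right ballI)
    show "totatives M \<subseteq> {..<M}" using M totatives_less by blast
  next
    fix n assume n: "n \<in> {..<M} - totatives M"
    hence "\<not> coprime n M" using M by (cases "n = 0") (auto simp: totatives_def)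
    thus "dchar M g a n = 0" by (simp add: dchar_def)
  qed auto
  also have "\<dots> = (\<Sum>i<\<phi>. dchar M g a (g ^ i mod M))"
    by (rule sum.reindex_bij_betw[OF bij, symmetric])
  also have "\<dots> = (\<Sum>i<\<phi>. cis (2 * pi * real a * real i / real \<phi>))"
  proof (intro sum.cong refl)
    fix i
    have cop: "coprime (g ^ i) M" using coprime_g by (simp add: coprime_commute)
    have "[dlog M g (g ^ i) = i] (mod \<phi>)" using cop by (subst dlog_cong_iff) auto
    thus "dchar M g a (g ^ i mod M) = cis (2 * pi * real a * real i / real \<phi>)"
      using cop cis_cong_mod[OF _ phi_pos] by (simp add: dchar_mod) (simp add: dchar_def)
  qed
  also have "\<dots> = 0" by (rule sum_roots_of_unity[OF phi_pos assms])
  finally show ?thesis .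
qed

lemma sum_dchar_lessThan_mod:
  assumes "\<not> \<phi> dvd a"
  shows "(\<Sum>n<x. dchar M g a n) = (\<Sum>n<x mod M. dchar M g a n)"
proof (induction x rule: less_induct)
  case (less x)
  show ?case
  proof (cases "x < M")
    case False
    define y where "y = x - M"
    have x: "x = y + M" using False by (simp add: y_def)
    have "(\<Sum>n<x. dchar M g a n) = (\<Sum>n<M. dchar M g a n) + (\<Sum>n=M..<x. dchar M g a n)"
      using False by (subst sum.union_disjoint[symmetric]) (auto intro!: sum.cong)
    also have "(\<Sum>n=M..<x. dchar M g a n) = (\<Sum>n<y. dchar M g a (n + M))"
      using sum.shift_bounds_nat_ivl[of "dchar M g a" 0 M y] by (simp add: x lessThan_atLeast0)
    also have "\<dots> = (\<Sum>n<y. dchar M g a n)"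
    proof (intro sum.cong refl)
      fix n show "dchar M g a (n + M) = dchar M g a n"
        using dchar_mod[of a "n + M"] dchar_mod[of a n] by simp
    qed
    also have "\<dots> = (\<Sum>n<x mod M. dchar M g a n)"
      using less.IH[of y] M by (simp add: x)
    finally show ?thesis using sum_dchar_period[OF assms] by simp
  qed auto
qed

lemma norm_sum_dchar_le:
  assumes "\<not> \<phi> dvd a"
  shows "norm (\<Sum>i\<in>{m<..n}. dchar M g a i) \<le> 2 * real M"
proof (cases "m \<le> n")
  case True
  have *: "norm (\<Sum>i<x. dchar M g a i) \<le> real M" for x
  proof -
    have "norm (\<Sum>i<x. dchar M g a i) \<le> (\<Sum>i<x mod M. 1)"
      unfolding sum_dchar_lessThan_mod[OF assms, of x]
      by (intro order.trans[OF norm_sum] sum_mono norm_dchar_le)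
    also have "\<dots> \<le> real M" using M by simp
    finally show ?thesis .
  qed
  \<comment> \<open>The interval sum is a difference of two prefix sums. Full periods cancel, so
    each prefix sum has norm at most \<open>M\<close>.\<close>
  have "(\<Sum>i<Suc n. dchar M g a i) = (\<Sum>i<Suc m. dchar M g a i) + (\<Sum>i\<in>{m<..n}. dchar M g a i)"
    using True by (subst sum.union_disjoint[symmetric]) (auto simp del: sum.lessThan_Suc intro!: sum.cong)
  hence "(\<Sum>i\<in>{m<..n}. dchar M g a i) = (\<Sum>i<Suc n. dchar M g a i) - (\<Sum>i<Suc m. dchar M g a i)"
    by simp
  also have "norm \<dots> \<le> real M + real M"
    by (intro order.trans[OF norm_triangle_ineq4] add_mono *)
  finally show ?thesis by simp
qed auto

lemma bounded_multiplicative_dchar: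
  assumes "\<not> \<phi> dvd a"
  shows "bounded_multiplicative (dchar M g a) (2 * real M)"
  using norm_sum_dchar_le[OF assms]
  by unfold_locales (auto intro: dchar_mult norm_dchar_le dchar_one[simplified])

text \<open>The exponent is symmetric in \<open>a\<close> and \<open>dlog M g n\<close>, so the sum
  over characters is again a sum of roots of unity.\<close>

lemma sum_dchar_orthogonal:
  "(\<Sum>a<\<phi>. dchar M g a n) = (if [n = 1] (mod M) then of_nat \<phi> else 0)"
proof (cases "coprime n M")
  case True
  have "[n = 1] (mod M) \<longleftrightarrow> [dlog M g n = 0] (mod \<phi>)"
    using dlog_cong_iff[OF True, of 0] by simp
  hence iff: "[n = 1] (mod M) \<longleftrightarrow> \<phi> dvd dlog M g n" by (simp add: cong_0_iff)
  show ?thesis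
  proof (cases "\<phi> dvd dlog M g n")
    case dvd: True
    hence "dlog M g n = 0" using dlog_less[OF True] by (auto dest: nat_dvd_not_less intro!: Nat.gr0I)
    thus ?thesis using True dvd iff by (simp add: dchar_def)
  next
    case False
    have "(\<Sum>a<\<phi>. dchar M g a n) = (\<Sum>a<\<phi>. cis (2 * pi * real (dlog M g n) * real a / real \<phi>))"
      using True by (simp add: dchar_def mult_ac)
    also have "\<dots> = 0" by (rule sum_roots_of_unity[OF phi_pos False])
    finally show ?thesis using False iff by simp
  qed
next
  case False
  hence "\<not> [n = 1] (mod M)"
    by (metis cong_imp_coprime cong_sym coprime_1_left)
  thus ?thesis using False by (simp add: dchar_def)
qed

lemma dchar_0: "dchar M g 0 n = (if coprime n M then 1 else 0)"
  by (simp add: dchar_def)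

lemma cnj_dchar:
  assumes "a \<le> \<phi>"
  shows "cnj (dchar M g a n) = dchar M g (\<phi> - a) n"
proof (cases "coprime n M")
  case True
  have "2 * pi * real (\<phi> - a) * real (dlog M g n) / real \<phi> =
        2 * pi * real (dlog M g n) + - (2 * pi * real a * real (dlog M g n) / real \<phi>)"
    using assms phi_pos by (simp add: of_nat_diff field_simps)
  also have "cis \<dots> = cis (- (2 * pi * real a * real (dlog M g n) / real \<phi>))"
    by (subst cis_mult[symmetric]) simp
  finally show ?thesis using True by (simp add: dchar_def cis_cnj)
qed (auto simp: dchar_def)

end

section \<open>Primes congruent to 1 modulo a power of 3\<close>

lemma sum_inverse_powers_le:
  assumes "p \<ge> (2 :: nat)"
  shows "(\<Sum>k=m..n. 1 / real p ^ k) \<le> 2 / real p ^ m"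
proof (cases "m \<le> n")
  case True
  \<comment> \<open>Subtracting the last term strengthens the claim enough for the
    induction.\<close>
  have "(\<Sum>k=m..n. 1 / real p ^ k) \<le> 2 / real p ^ m - 1 / real p ^ n"
    using True
  proof (induction n rule: dec_induct)
    case (step n)
    have "2 * (1 / real p ^ Suc n) \<le> 1 / real p ^ n"
      using assms by (simp add: field_simps)
    thus ?case using step by simp
  qed simp
  also have "\<dots> \<le> 2 / real p ^ m" by simp
  finally show ?thesis .
qed simp

text \<open>Among the multiples of \<open>p\<close> only the powers of \<open>p\<close> contribute,
  and they form a geometric series. Exponents up to \<open>x\<close> suffice because
  \<open>k < p ^ k\<close>.\<close>

lemma sum_mangoldt_multiples_le:
  assumes "prime p"
  shows "(\<Sum>n | n \<in> {1..x} \<and> p dvd n. mangoldt n / real n) \<le> 2 * ln (real p) / real p"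
proof -
  have p: "p \<ge> 2" using assms by (rule prime_ge_2_nat)
  have "(\<Sum>n | n \<in> {1..x} \<and> p dvd n. mangoldt n / real n) =
        (\<Sum>n | n \<in> {1..x} \<and> p dvd n \<and> primepow n. mangoldt n / real n)"
    by (intro sum.mono_neutral_right) (auto simp: mangoldt_def)
  also have "\<dots> \<le> (\<Sum>n\<in>(\<lambda>k. p ^ k) ` {1..x}. mangoldt n / real n)"
  proof (rule sum_mono2)
    show "{n. n \<in> {1..x} \<and> p dvd n \<and> primepow n} \<subseteq> (\<lambda>k. p ^ k) ` {1..x}"
    proof safe
      fix n assume n: "n \<in> {1..x}" "p dvd n" "primepow n"
      then obtain q k where q: "prime q" "k > 0" "n = q ^ k" by (auto simp: primepow_def)
      with n assms have "p = q" by (metis prime_dvd_power primes_dvd_imp_eq)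
      moreover have "k < p ^ k" using p by (intro power_gt_expt) auto
      ultimately show "n \<in> (\<lambda>k. p ^ k) ` {1..x}" using n q by auto
    qed
  qed (auto intro!: divide_nonneg_nonneg mangoldt_nonneg)
  also have "\<dots> \<le> (\<Sum>k=1..x. mangoldt (p ^ k) / real (p ^ k))"
    by (rule sum_image_le[of "{1..x}" "\<lambda>n. mangoldt n / real n" "\<lambda>k. p ^ k", unfolded o_def])
       (auto intro!: divide_nonneg_nonneg mangoldt_nonneg)
  also have "\<dots> = ln (real p) * (\<Sum>k=1..x. 1 / real p ^ k)"
    unfolding sum_distrib_left using assms by (intro sum.cong refl) auto
  also have "\<dots> \<le> ln (real p) * (2 / real p ^ 1)"
    using p by (intro mult_left_mono sum_inverse_powers_le) auto
  finally show ?thesis by (simp add: mult_ac)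
qed

text \<open>Proper powers of \<open>p\<close> contribute at most \<open>2 * ln p / p^2\<close>; by
  \<open>ln p \<le> 2 * sqrt p\<close> this is dominated by a convergent series with exponent
  \<open>-3/2\<close>.\<close>

lemma sum_mangoldt_nonprime_bounded:
  "\<exists>C. \<forall>x. (\<Sum>n | n \<in> {1..x} \<and> \<not> prime n. mangoldt n / real n) \<le> C"
proof (intro exI allI)
  fix x :: nat
  let ?P = "{p \<in> {1..x}. prime p}"
  have "(\<Sum>n | n \<in> {1..x} \<and> \<not> prime n. mangoldt n / real n) =
        (\<Sum>n | n \<in> {1..x} \<and> \<not> prime n \<and> primepow n. mangoldt n / real n)"
    by (intro sum.mono_neutral_right) (auto simp: mangoldt_def)
  also have "\<dots> \<le> (\<Sum>n\<in>(\<lambda>(p, k). p ^ k) ` (?P \<times> {2..x}). mangoldt n / real n)"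
  proof (rule sum_mono2)
    show "{n. n \<in> {1..x} \<and> \<not> prime n \<and> primepow n} \<subseteq> (\<lambda>(p, k). p ^ k) ` (?P \<times> {2..x})"
    proof safe
      fix n :: nat assume n: "n \<in> {1..x}" "\<not> prime n" "primepow n"
      then obtain q k where q: "prime q" "k > 0" "n = q ^ k" by (auto simp: primepow_def)
      with n have "k \<noteq> 1" by auto
      moreover have "k < q ^ k" using prime_ge_2_nat[OF q(1)] by (intro power_gt_expt) auto
      moreover have "q \<le> q ^ k" using q prime_gt_0_nat[OF q(1)] by (intro self_le_power) auto
      ultimately have "(q, k) \<in> ?P \<times> {2..x}"
        using n q prime_gt_0_nat[OF q(1)] by auto
      thus "n \<in> (\<lambda>(p, k). p ^ k) ` (?P \<times> {2..x})" using q(3) by force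
    qed
  qed (auto intro!: divide_nonneg_nonneg mangoldt_nonneg)
  also have "\<dots> \<le> (\<Sum>z\<in>?P \<times> {2..x}. mangoldt (case z of (p, k) \<Rightarrow> p ^ k) / real (case z of (p, k) \<Rightarrow> p ^ k))"
    by (rule sum_image_le[of _ "\<lambda>n. mangoldt n / real n", unfolded o_def])
       (auto intro!: divide_nonneg_nonneg mangoldt_nonneg)
  also have "\<dots> = (\<Sum>p\<in>?P. \<Sum>k=2..x. mangoldt (p ^ k) / real (p ^ k))"
    by (subst sum.cartesian_product) (auto intro!: sum.cong)
  also have "\<dots> = (\<Sum>p\<in>?P. ln (real p) * (\<Sum>k=2..x. 1 / real p ^ k))"
    unfolding sum_distrib_left by (intro sum.cong refl) auto
  also have "\<dots> \<le> (\<Sum>p\<in>?P. 4 * real p powr (-3/2))"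
  proof (intro sum_mono)
    fix p assume "p \<in> ?P"
    hence p: "p \<ge> 2" by (auto dest: prime_ge_2_nat)
    have "ln (real p) = 2 * ln (sqrt (real p))" using p by (simp add: ln_sqrt)
    also have "\<dots> \<le> 2 * sqrt (real p)"
      using ln_le_minus_one[of "sqrt (real p)"] p by simp
    finally have *: "ln (real p) \<le> 2 * sqrt (real p)" .
    have "ln (real p) * (\<Sum>k=2..x. 1 / real p ^ k) \<le> (2 * sqrt (real p)) * (2 / real p ^ 2)"
      using p * by (intro mult_mono sum_inverse_powers_le) (auto intro!: sum_nonneg)
    also have "\<dots> = 4 * (real p powr (1/2) / real p powr 2)"
      using p by (simp add: powr_half_sqrt powr_numeral)
    also have "\<dots> = 4 * real p powr (-3/2)"
      by (subst powr_diff[symmetric]) simp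
    finally show "ln (real p) * (\<Sum>k=2..x. 1 / real p ^ k) \<le> 4 * real p powr (-3/2)" .
  qed
  also have "\<dots> \<le> (\<Sum>p. 4 * real p powr (-3/2))"
    by (rule sum_le_suminf) (auto intro!: summable_mult simp: summable_real_powr_iff)
  finally show "(\<Sum>n | n \<in> {1..x} \<and> \<not> prime n. mangoldt n / real n) \<le> (\<Sum>p. 4 * real p powr (-3/2))" .
qed

section \<open>Characters modulo a power of 3 and the nonvanishing of
  \<open>L(1, \<xi>)\<close>\<close>

locale primroot_power_3 = primroot_modulus M g for M g +
  fixes j :: nat
  assumes M_eq: "M = 3 ^ j"
begin

lemma j_pos: "j > 0"
  using M by (cases j) (auto simp: M_eq)

lemma dvd_M: "3 dvd M"
  using j_pos by (simp add: M_eq)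

lemma coprime_M_iff: "coprime n M \<longleftrightarrow> \<not> 3 dvd n"
proof -
  have "coprime n M \<longleftrightarrow> coprime n 3"
    using j_pos by (simp add: M_eq coprime_power_right_iff)
  also have "\<dots> \<longleftrightarrow> \<not> 3 dvd n"
    using prime_imp_coprime[of 3 n] coprime_common_divisor[of n 3 3] by (auto simp: coprime_commute)
  finally show ?thesis .
qed

abbreviation AA :: "nat \<Rightarrow> nat \<Rightarrow> complex" where
  "AA a x \<equiv> \<Sum>n=1..x. dchar M g a n * mangoldt n / of_nat n"

text \<open>The principal character merely deletes the multiples of 3, which contribute between 0
  and 2; the rest is Mertens' estimate.\<close>

lemma AA_principal:
  assumes "x > 0"
  shows "Re (AA 0 x) \<ge> ln (real x) - 3" "Re (AA 0 x) \<le> ln (real x) + 4"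
proof -
  let ?f = "\<lambda>n. mangoldt n / real n"
  have "Re (AA 0 x) = (\<Sum>n=1..x. if 3 dvd n then 0 else ?f n)"
    unfolding Re_sum by (intro sum.cong refl) (auto simp: dchar_0 coprime_M_iff)
  also have "\<dots> = (\<Sum>n=1..x. ?f n) - (\<Sum>n | n \<in> {1..x} \<and> 3 dvd n. ?f n)"
    by (subst sum.inter_filter) (auto simp: sum_subtractf[symmetric] intro!: sum.cong)
  finally have eq: "Re (AA 0 x) = (\<Sum>n=1..x. ?f n) - (\<Sum>n | n \<in> {1..x} \<and> 3 dvd n. ?f n)" .
  have "(\<Sum>n | n \<in> {1..x} \<and> 3 dvd n. ?f n) \<le> 2 * ln 3 / 3"
    using sum_mangoldt_multiples_le[of 3 x] by simp
  also have "\<dots> \<le> 2" using ln_le_minus_one[of 3] by simp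
  finally show "Re (AA 0 x) \<ge> ln (real x) - 3"
    using mertens_mangoldt_lower[OF assms] eq by linarith
  have "(\<Sum>n | n \<in> {1..x} \<and> 3 dvd n. ?f n) \<ge> 0"
    by (intro sum_nonneg divide_nonneg_nonneg mangoldt_nonneg) auto
  thus "Re (AA 0 x) \<le> ln (real x) + 4"
    using mertens_mangoldt_upper[OF assms] eq by linarith
qed

lemma sum_AA:
  "(\<Sum>a<\<phi>. Re (AA a x)) = real \<phi> * (\<Sum>n | n \<in> {1..x} \<and> [n = 1] (mod M). mangoldt n / real n)"
proof -
  have "(\<Sum>a<\<phi>. AA a x) = (\<Sum>n=1..x. (\<Sum>a<\<phi>. dchar M g a n) * mangoldt n / of_nat n)"
    by (subst sum.swap) (simp add: sum_distrib_right sum_divide_distrib)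
  also have "\<dots> = (\<Sum>n | n \<in> {1..x} \<and> [n = 1] (mod M). of_nat \<phi> * mangoldt n / of_nat n)"
    by (subst sum.inter_filter) (auto simp: sum_dchar_orthogonal intro!: sum.cong)
  finally have "Re (\<Sum>a<\<phi>. AA a x) = Re (\<Sum>n | n \<in> {1..x} \<and> [n = 1] (mod M). of_nat \<phi> * mangoldt n / of_nat n)"
    by (rule arg_cong)
  also have "\<dots> = real \<phi> * (\<Sum>n | n \<in> {1..x} \<and> [n = 1] (mod M). mangoldt n / real n)"
    unfolding Re_sum sum_distrib_left by (intro sum.cong refl) simp
  also have "Re (\<Sum>a<\<phi>. AA a x) = (\<Sum>a<\<phi>. Re (AA a x))" by (rule Re_sum)
  finally show ?thesis .
qed

lemma not_dvd: "0 < a \<Longrightarrow> a < \<phi> \<Longrightarrow> \<not> \<phi> dvd a"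
  by (auto dest: dvd_imp_le)

lemma Re_AA_bounded_above:
  assumes "0 < a" "a < \<phi>"
  shows "\<exists>C. \<forall>x>0. Re (AA a x) \<le> C"
proof -
  interpret bounded_multiplicative "dchar M g a" "2 * real M"
    by (rule bounded_multiplicative_dchar) (rule not_dvd[OF assms])
  show ?thesis using Re_A_bounded_above unfolding A_def .
qed

abbreviation LL :: "nat \<Rightarrow> complex" where
  "LL a \<equiv> bounded_multiplicative.L (dchar M g a)"

lemma LL_tendsto:
  assumes "0 < a" "a < \<phi>"
  shows "(\<lambda>x. \<Sum>n=1..x. dchar M g a n / of_nat n) \<longlonglongrightarrow> LL a"
proof -
  interpret bounded_multiplicative "dchar M g a" "2 * real M"
    by (rule bounded_multiplicative_dchar) (rule not_dvd[OF assms])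
  show ?thesis using T_tendsto unfolding T_def .
qed

text \<open>Each vanishing value contributes \<open>- ln x\<close> to the sum over all characters,
  against the single \<open>ln x\<close> of the principal one.\<close>

lemma LL_eq_0_imp:
  assumes "0 < a" "a < \<phi>" "LL a = 0" "x > 0"
  shows "Re (AA a x) \<le> 2 * real M - ln (real x)"
proof -
  interpret bounded_multiplicative "dchar M g a" "2 * real M"
    by (rule bounded_multiplicative_dchar) (rule not_dvd[OF assms(1,2)])
  have "Re (A x + of_real (ln (real x))) \<le> 2 * real M"
    using A_plus_ln_bounded[OF assms(3,4)] complex_Re_le_cmod order.trans by blast
  thus ?thesis by (simp add: A_def)
qed

lemma LL_neq_0_imp:
  assumes "0 < a" "a < \<phi>" "LL a \<noteq> 0"
  shows "\<exists>C. \<forall>x. Re (AA a x) \<ge> C"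
proof -
  interpret bounded_multiplicative "dchar M g a" "2 * real M"
    by (rule bounded_multiplicative_dchar) (rule not_dvd[OF assms(1,2)])
  have "Re (A x) \<ge> - ((3 + 5 * (2 * real M)) / norm L)" for x
    using A_bounded[OF assms(3), of x] abs_Re_le_cmod[of "A x"] by linarith
  thus ?thesis unfolding A_def by blast
qed

text \<open>Two vanishing values \<open>L(1, \<xi>)\<close> would force the sum over the residue class of 1, a sum of
  nonnegative terms, to tend to minus infinity.\<close>

lemma LL_nonreal_neq_0:
  assumes a: "0 < a" "a < \<phi>" "2 * a \<noteq> \<phi>"
  shows "LL a \<noteq> 0"
proof
  assume L0: "LL a = 0"
  \<comment> \<open>The index of the conjugate character, distinct from \<open>a\<close> because
    \<open>2 * a \<noteq> \<phi>\<close>; its value at 1 vanishes by conjugating the limit.\<close>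
  define a' where "a' = \<phi> - a"
  have a': "0 < a'" "a' < \<phi>" "a' \<noteq> a" using a by (auto simp: a'_def)
  have "(\<lambda>x. cnj (\<Sum>n=1..x. dchar M g a n / of_nat n)) \<longlonglongrightarrow> cnj (LL a)"
    by (intro tendsto_cnj LL_tendsto a)
  also have "(\<lambda>x. cnj (\<Sum>n=1..x. dchar M g a n / of_nat n)) = (\<lambda>x. \<Sum>n=1..x. dchar M g a' n / of_nat n)"
    using a by (simp add: cnj_dchar a'_def)
  finally have "LL a' = 0"
    using LL_tendsto[OF a'(1,2)] L0 LIMSEQ_unique by fastforce
  define R where "R = {1..<\<phi>} - {a, a'}"
  have "\<forall>b\<in>R. \<exists>C. \<forall>x>0. Re (AA b x) \<le> C"
    by (intro ballI Re_AA_bounded_above) (auto simp: R_def)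
  then obtain C where C: "\<And>b x. b \<in> R \<Longrightarrow> x > 0 \<Longrightarrow> Re (AA b x) \<le> C b"
    by metis
  have bound: "ln (real x) \<le> 4 + 4 * real M + sum C R" if x: "x > 0" for x
  proof -
    have "0 \<le> (\<Sum>b<\<phi>. Re (AA b x))"
      unfolding sum_AA by (intro mult_nonneg_nonneg sum_nonneg divide_nonneg_nonneg mangoldt_nonneg) auto
    also have "{..<\<phi>} = insert 0 (insert a (insert a' R))"
      using a a' phi_pos by (auto simp: R_def simp del: totient_gt_0_iff)
    also have "(\<Sum>b\<in>\<dots>. Re (AA b x)) = Re (AA 0 x) + (Re (AA a x) + (Re (AA a' x) + (\<Sum>b\<in>R. Re (AA b x))))"
    proof -
      have "finite R" "a' \<notin> R" "a \<notin> insert a' R" "0 \<notin> insert a (insert a' R)"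
        using a a' by (auto simp: R_def)
      thus ?thesis by (simp only: sum.insert finite_insert simp_thms)
    qed
    \<comment> \<open>One \<open>ln x\<close> from the principal character and two
      \<open>- ln x\<close> leave \<open>- ln x\<close> plus a constant, which must be nonnegative
      for all \<open>x\<close>.\<close>
    also have "\<dots> \<le> (ln (real x) + 4) + ((2 * real M - ln (real x)) + ((2 * real M - ln (real x)) + sum C R))"
      by (intro add_mono AA_principal(2) LL_eq_0_imp sum_mono C a a' L0 \<open>LL a' = 0\<close> x)
    finally show ?thesis by simp
  qed
  obtain N :: nat where N: "exp (5 + 4 * real M + sum C R) < real N" using reals_Archimedean2 by blast
  hence "N > 0" using exp_gt_zero[of "5 + 4 * real M + sum C R"] by (intro Nat.gr0I) (simp add: not_less)
  hence "5 + 4 * real M + sum C R < ln (real N)" using N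
    by (metis exp_gt_zero ln_exp ln_less_cancel_iff of_nat_0_less_iff)
  thus False using bound[OF \<open>N > 0\<close>] by simp
qed

text \<open>If \<open>g\<close> were 1 modulo 3, so would be all its powers, and none could be
  congruent to 2.\<close>

lemma g_mod_3: "g mod 3 = 2"
proof -
  have "coprime g M" using coprime_g by (simp add: coprime_commute)
  hence "g mod 3 \<noteq> 0" by (simp add: coprime_M_iff dvd_eq_mod_eq_0)
  moreover have "g mod 3 \<noteq> 1"
  proof
    assume "g mod 3 = 1"
    hence "[g ^ dlog M g 2 = 1 ^ dlog M g 2] (mod 3)"
      by (intro cong_pow) (simp add: cong_def)
    moreover have "[g ^ dlog M g 2 = 2] (mod 3)"
      by (rule cong_dvd_modulus_nat[OF power_dlog dvd_M]) (simp add: coprime_M_iff)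
    ultimately show False by (simp add: cong_def)
  qed
  ultimately show ?thesis by linarith
qed

text \<open>For \<open>a = \<phi> / 2\<close> the character is -1 to the power
  \<open>dlog M g n\<close>. Since \<open>g\<close> is 2 modulo 3, the residue of \<open>n\<close>
  modulo 3 reveals the parity of that logarithm.\<close>

lemma dchar_quadratic:
  assumes "2 * a = \<phi>"
  shows "dchar M g a n = (if n mod 3 = 1 then 1 else if n mod 3 = 2 then -1 else 0)"
proof (cases "3 dvd n")
  case True
  thus ?thesis by (auto simp: dchar_def coprime_M_iff)
next
  case False
  define i where "i = dlog M g n"
  have "a > 0" using assms phi_pos by linarith
  have "2 * pi * real a * real i / real \<phi> = pi * real i"
    using \<open>a > 0\<close> by (simp flip: assms)
  hence "dchar M g a n = cis (pi * real i)"
    using False by (simp add: dchar_def coprime_M_iff i_def)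
  also have "\<dots> = (cis pi) ^ i" unfolding Complex.DeMoivre by (simp only: mult.commute)
  finally have dchar: "dchar M g a n = (-1) ^ i" by simp
  have "[g ^ i = n] (mod 3)"
    unfolding i_def by (rule cong_dvd_modulus_nat[OF power_dlog dvd_M]) (simp add: coprime_M_iff False)
  hence n: "n mod 3 = 2 ^ i mod 3"
    using g_mod_3 by (metis cong_def power_mod)
  have "(2::nat) ^ i mod 3 = (if even i then 1 else 2)"
  proof (induction i)
    case (Suc i)
    have "(2::nat) ^ Suc i mod 3 = (2 * (2 ^ i mod 3)) mod 3" by (simp add: mod_mult_right_eq)
    thus ?case using Suc by (auto split: if_splits)
  qed auto
  thus ?thesis using n dchar by auto
qed

text \<open>The series is \<open>1 - 1/2 + 1/4 - 1/5 + ...\<close>. Taken in blocks of three indices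
  its increments are nonnegative and the first is \<open>1/2\<close>, so the limit has real part at
  least \<open>1/2\<close>.\<close>

lemma LL_real_neq_0:
  assumes a: "2 * a = \<phi>"
  shows "LL a \<noteq> 0"
proof -
  have a': "0 < a" "a < \<phi>" using a phi_pos by linarith+
  define T where "T = (\<lambda>x. \<Sum>n=1..x. dchar M g a n / of_nat n)"
  have T: "T \<longlonglongrightarrow> LL a" unfolding T_def by (rule LL_tendsto[OF a'])
  have T_Suc: "T (Suc n) = T n + dchar M g a (Suc n) / of_nat (Suc n)" for n
    by (simp add: T_def)
  have step: "T (3 * Suc m) = T (3 * m) + of_real (1 / real (3*m+1) - 1 / real (3*m+2))" for m
  proof -
    have "3 * Suc m = Suc (Suc (Suc (3 * m)))" by simp
    moreover have "Suc (3 * m) mod 3 = 1" "Suc (Suc (3 * m)) mod 3 = 2" "Suc (Suc (Suc (3 * m))) mod 3 = 0"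
      by presburger+
    ultimately show ?thesis by (simp only: T_Suc dchar_quadratic[OF a]) (simp add: algebra_simps)
  qed
  have ge: "Re (T (3 * Suc m)) \<ge> 1 / 2" for m
  proof (induction m)
    case 0
    have "T 0 = 0" by (simp add: T_def)
    thus ?case unfolding step[of 0] by simp
  next
    case (Suc m)
    have "1 / real (3 * Suc m + 1) - 1 / real (3 * Suc m + 2) \<ge> 0" by (simp add: field_simps)
    thus ?case using Suc unfolding step[of "Suc m"] by simp
  qed
  have "(\<lambda>m. Re (T (3 * Suc m))) \<longlonglongrightarrow> Re (LL a)"
    by (intro tendsto_Re LIMSEQ_subseq_LIMSEQ[OF T, of "\<lambda>m. 3 * Suc m", unfolded o_def])
       (simp add: strict_mono_def)
  hence "Re (LL a) \<ge> 1 / 2"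
    by (rule tendsto_lowerbound) (use ge in auto)
  thus ?thesis by auto
qed

text \<open>With no value \<open>L(1, \<xi>)\<close> equal to zero, every nonprincipal sum is
  bounded below; orthogonality then leaves \<open>ln x\<close> from the principal character, divided
  by \<open>\<phi>\<close>.\<close>

lemma mangoldt_residue_1_lower:
  "\<exists>C. \<forall>x>0. (\<Sum>n | n \<in> {1..x} \<and> [n = 1] (mod M). mangoldt n / real n) \<ge> ln (real x) / real \<phi> - C"
proof -
  have "\<forall>b\<in>{1..<\<phi>}. \<exists>C. \<forall>x. Re (AA b x) \<ge> C"
  proof
    fix b assume b: "b \<in> {1..<\<phi>}"
    have "LL b \<noteq> 0"
      using b LL_nonreal_neq_0[of b] LL_real_neq_0[of b] by (cases "2 * b = \<phi>") auto
    thus "\<exists>C. \<forall>x. Re (AA b x) \<ge> C" using b by (intro LL_neq_0_imp) auto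
  qed
  then obtain C where C: "\<And>b x. b \<in> {1..<\<phi>} \<Longrightarrow> Re (AA b x) \<ge> C b"
    by metis
  show ?thesis
  proof (intro exI allI impI)
    fix x :: nat assume x: "x > 0"
    have "(ln (real x) - 3) + sum C {1..<\<phi>} \<le> Re (AA 0 x) + (\<Sum>b\<in>{1..<\<phi>}. Re (AA b x))"
      by (intro add_mono sum_mono AA_principal(1)[OF x] C)
    also have "\<dots> = (\<Sum>b\<in>insert 0 {1..<\<phi>}. Re (AA b x))"
      by (subst sum.insert) auto
    also have "insert 0 {1..<\<phi>} = {..<\<phi>}" using phi_pos by auto
    finally show "(\<Sum>n | n \<in> {1..x} \<and> [n = 1] (mod M). mangoldt n / real n) \<ge>
                     ln (real x) / real \<phi> - (3 - sum C {1..<\<phi>}) / real \<phi>"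
      unfolding sum_AA using phi_pos by (simp add: field_simps)
  qed
qed

end

lemma mertens_residue_1_mod_power_3:
  "\<exists>C. \<forall>x>0. (\<Sum>p | p \<in> {1..x} \<and> prime p \<and> [p = 1] (mod 3 ^ j). ln (real p) / real p) \<ge>
               ln (real x) / real (totient (3 ^ j)) - C"
proof -
  have "\<exists>C. \<forall>x>0. (\<Sum>n | n \<in> {1..x} \<and> [n = 1] (mod 3 ^ j). mangoldt n / real n) \<ge>
               ln (real x) / real (totient (3 ^ j)) - C"
  \<comment> \<open>Modulus 1 lies outside the character argument, which has \<open>M > 1\<close>;
    there the claim is plain Mertens.\<close>
  proof (cases "j = 0")
    case True
    have "(\<Sum>n | n \<in> {1..x} \<and> [n = 1] (mod 1). mangoldt n / real n) \<ge> ln (real x) - 1" if "x > 0" for x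
    proof -
      have "{n. n \<in> {1..x} \<and> [n = 1] (mod 1)} = {1..x}" by auto
      thus ?thesis using mertens_mangoldt_lower[OF that] by simp
    qed
    thus ?thesis using True by auto
  next
    case False
    obtain g where "\<forall>k>0. residue_primroot (3 ^ k) (g :: nat)"
      by (rule residue_primroot_odd_prime_power_exists[of 3]) auto
    then interpret primroot_power_3 "3 ^ j" g j
      using False one_less_power[of "3 :: nat" j] by unfold_locales auto
    show ?thesis by (rule mangoldt_residue_1_lower)
  qed
  then obtain C1 where C1: "\<And>x. x > 0 \<Longrightarrow>
      (\<Sum>n | n \<in> {1..x} \<and> [n = 1] (mod 3 ^ j). mangoldt n / real n) \<ge> ln (real x) / real (totient (3 ^ j)) - C1"
    by blast
  obtain C2 where C2: "\<And>x. (\<Sum>n | n \<in> {1..x} \<and> \<not> prime n. mangoldt n / real n) \<le> C2"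
    using sum_mangoldt_nonprime_bounded by blast
  show ?thesis
  proof (intro exI allI impI)
    fix x :: nat assume x: "x > 0"
    let ?f = "\<lambda>n. mangoldt n / real n"
    have "(\<Sum>n | n \<in> {1..x} \<and> [n = 1] (mod 3 ^ j). ?f n) =
          (\<Sum>n | n \<in> {1..x} \<and> prime n \<and> [n = 1] (mod 3 ^ j). ?f n) +
          (\<Sum>n | n \<in> {1..x} \<and> \<not> prime n \<and> [n = 1] (mod 3 ^ j). ?f n)"
      by (subst sum.union_disjoint[symmetric]) (auto intro!: sum.cong)
    also have "(\<Sum>n | n \<in> {1..x} \<and> \<not> prime n \<and> [n = 1] (mod 3 ^ j). ?f n) \<le>
               (\<Sum>n | n \<in> {1..x} \<and> \<not> prime n. ?f n)"
      by (intro sum_mono2) (auto intro!: divide_nonneg_nonneg mangoldt_nonneg)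
    also have "\<dots> \<le> C2" by (rule C2)
    also have "(\<Sum>n | n \<in> {1..x} \<and> prime n \<and> [n = 1] (mod 3 ^ j). ?f n) =
               (\<Sum>p | p \<in> {1..x} \<and> prime p \<and> [p = 1] (mod 3 ^ j). ln (real p) / real p)"
      by (intro sum.cong refl) auto
    finally show "(\<Sum>p | p \<in> {1..x} \<and> prime p \<and> [p = 1] (mod 3 ^ j). ln (real p) / real p) \<ge>
               ln (real x) / real (totient (3 ^ j)) - (C1 + C2)"
      using C1[OF x] by linarith
  qed
qed

section \<open>Moduli with few attained residues\<close>

lemma gcd_power_3_eq_sum_totient:
  "gcd (3 ^ J) n = (\<Sum>i | i \<le> J \<and> 3 ^ i dvd n. totient (3 ^ i))"
proof -
  have "gcd (3 ^ J) n = (\<Sum>d | d dvd gcd (3 ^ J) n. totient d)"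
    by (rule totient_divisor_sum[symmetric])
  also have "{d. d dvd gcd (3 ^ J) n} = (\<lambda>i. 3 ^ i) ` {i. i \<le> J \<and> 3 ^ i dvd n}"
    by (auto simp: divides_primepow_nat)
  also have "(\<Sum>d\<in>\<dots>. totient d) = (\<Sum>i | i \<le> J \<and> 3 ^ i dvd n. totient (3 ^ i))"
    by (subst sum.reindex) (auto intro!: inj_onI)
  finally show ?thesis .
qed

lemma card_multiples: "e > 0 \<Longrightarrow> card {n \<in> {1..N}. e dvd n} = N div (e::nat)"
proof -
  assume e: "e > 0"
  have "{n \<in> {1..N}. e dvd n} = (\<lambda>i. e * i) ` {1..N div e}"
  proof safe
    fix n assume n: "n \<in> {1..N}" "e dvd n"
    then obtain i where "n = e * i" by auto
    with n e show "n \<in> (\<lambda>i. e * i) ` {1..N div e}"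
      by (auto simp: less_eq_div_iff_mult_less_eq mult.commute intro!: Nat.gr0I image_eqI[of _ _ i])
  qed (use e in \<open>auto simp: less_eq_div_iff_mult_less_eq mult.commute Suc_le_eq\<close>)
  thus ?thesis using e by (simp add: card_image inj_on_def)
qed

text \<open>It suffices that \<open>q div gcd D q\<close> divides \<open>n\<close>; counting its
  multiples up to \<open>N\<close> loses at most 1 by rounding.\<close>

lemma card_dvd_mult_ge:
  assumes "q > 0" "D > 0"
  shows "real (card {n \<in> {1..N}. q dvd D * n}) \<ge> real N * real (gcd D q) / real q - 1"
proof -
  define e where "e = q div gcd D q"
  have q: "q = gcd D q * e" by (simp add: e_def)
  hence e: "e > 0" using assms by (metis gr0I mult_0_right)
  have "real N = real (N div e) * real e + real (N mod e)"
    by (metis div_mult_mod_eq of_nat_add of_nat_mult)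
  also have "\<dots> \<le> real (N div e) * real e + real e" using e by simp
  finally have "real N / real e - 1 \<le> real (N div e)" using e by (simp add: field_simps)
  also have "N div e = card {n \<in> {1..N}. e dvd n}" using e by (rule card_multiples[symmetric])
  also have "real \<dots> \<le> real (card {n \<in> {1..N}. q dvd D * n})"
  proof (intro of_nat_mono card_mono)
    have "q dvd D * n" if "e dvd n" for n
      using mult_dvd_mono[OF gcd_dvd1[of D q] that] q by metis
    thus "{n \<in> {1..N}. e dvd n} \<subseteq> {n \<in> {1..N}. q dvd D * n}" by blast
  qed auto
  also have "real N / real e = real N * real (gcd D q) / real q"
  proof -
    have "real q = real (gcd D q) * real e" using q by (metis of_nat_mult)
    moreover have "gcd D q > 0" using assms by simp
    ultimately show ?thesis using e by (simp add: field_simps)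
  qed
  finally show ?thesis .
qed

text \<open>Each \<open>i \<le> J\<close> contributes \<open>totient (3 ^ i)\<close> times a sum of
  size \<open>ln N / totient (3 ^ i)\<close>, hence \<open>ln N\<close> up to a constant; there are
  \<open>J + 1\<close> such terms.\<close>

lemma sum_gcd_primes_lower:
  "\<exists>C. \<forall>N>0. (\<Sum>p | p \<in> {1..N} \<and> prime p. real (gcd (3 ^ J) (p - 1)) * ln (real p) / real p) \<ge>
               real (Suc J) * ln (real N) - C"
proof -
  have "\<forall>i. \<exists>C. \<forall>x>0. (\<Sum>p | p \<in> {1..x} \<and> prime p \<and> [p = 1] (mod 3 ^ i). ln (real p) / real p) \<ge>
               ln (real x) / real (totient (3 ^ i)) - C"
    by (intro allI mertens_residue_1_mod_power_3)
  from choice[OF this] obtain C where C: "\<forall>i. \<forall>x>0.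
      (\<Sum>p | p \<in> {1..x} \<and> prime p \<and> [p = 1] (mod 3 ^ i). ln (real p) / real p) \<ge>
               ln (real x) / real (totient (3 ^ i)) - C i" ..
  show ?thesis
  proof (intro exI allI impI)
    fix N :: nat assume N: "N > 0"
    let ?P = "{p. p \<in> {1..N} \<and> prime p}"
    let ?t = "\<lambda>i. real (totient (3 ^ i))"
    let ?f = "\<lambda>p. ln (real p) / real p"
    have t: "?t i > 0" for i by simp
    have "real (Suc J) * ln (real N) - (\<Sum>i\<le>J. ?t i * C i) = (\<Sum>i\<le>J. ?t i * (ln (real N) / ?t i - C i))"
      by (simp add: right_diff_distrib sum_subtractf)
    also have "\<dots> \<le> (\<Sum>i\<le>J. ?t i * (\<Sum>p | p \<in> {1..N} \<and> prime p \<and> [p = 1] (mod 3 ^ i). ?f p))"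
      using t by (intro sum_mono mult_left_mono C[rule_format, OF N] less_imp_le)
    also have "\<dots> = (\<Sum>i\<le>J. \<Sum>p\<in>?P. if 3 ^ i dvd p - 1 then ?t i * ?f p else 0)"
    proof (intro sum.cong refl)
      fix i
      have "{p. p \<in> {1..N} \<and> prime p \<and> [p = 1] (mod 3 ^ i)} = {p \<in> ?P. 3 ^ i dvd p - 1}"
        by (auto simp: cong_altdef_nat)
      thus "?t i * (\<Sum>p | p \<in> {1..N} \<and> prime p \<and> [p = 1] (mod 3 ^ i). ?f p) =
            (\<Sum>p\<in>?P. if 3 ^ i dvd p - 1 then ?t i * ?f p else 0)"
        by (simp only: sum_distrib_left) (rule sum.inter_filter, simp)
    qed
    also have "\<dots> = (\<Sum>p\<in>?P. \<Sum>i\<le>J. if 3 ^ i dvd p - 1 then ?t i * ?f p else 0)"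
      by (rule sum.swap)
    also have "\<dots> = (\<Sum>p\<in>?P. real (gcd (3 ^ J) (p - 1)) * ln (real p) / real p)"
    proof (intro sum.cong refl)
      fix p
      have "(\<Sum>i\<le>J. if 3 ^ i dvd p - 1 then ?t i * ?f p else 0) = (\<Sum>i\<in>{i\<in>{..J}. 3 ^ i dvd p - 1}. ?t i * ?f p)"
        by (rule sum.inter_filter[symmetric]) simp
      also have "\<dots> = real (gcd (3 ^ J) (p - 1)) * ?f p"
        unfolding gcd_power_3_eq_sum_totient of_nat_sum sum_distrib_right atMost_iff ..
      finally show "(\<Sum>i\<le>J. if 3 ^ i dvd p - 1 then ?t i * ?f p else 0) = 
                    real (gcd (3 ^ J) (p - 1)) * ln (real p) / real p" by simp
    qed
    finally show "(\<Sum>p\<in>?P. real (gcd (3 ^ J) (p - 1)) * ln (real p) / real p) \<ge>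
                    real (Suc J) * ln (real N) - (\<Sum>i\<le>J. ?t i * C i)" .
  qed
qed

text \<open>Some \<open>n\<close> reaches the mean over \<open>n \<le> N\<close>. After exchanging
  sums, each prime \<open>p\<close> is weighted by the number of \<open>n\<close> for which
  \<open>p - 1\<close> divides \<open>3 ^ J * n\<close>.\<close>

lemma exists_many_primes_pred_dvd:
  "\<exists>C. \<forall>N>0. \<exists>n\<in>{1..N}.
     (\<Sum>p | p \<in> {1..N} \<and> prime p \<and> p - 1 dvd 3 ^ J * n. ln (real p)) \<ge> real (Suc J) * ln (real N) - C"
proof -
  obtain C where C: "\<And>N. N > 0 \<Longrightarrow>
      (\<Sum>p | p \<in> {1..N} \<and> prime p. real (gcd (3 ^ J) (p - 1)) * ln (real p) / real p) \<ge>
               real (Suc J) * ln (real N) - C"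
    using sum_gcd_primes_lower by blast
  show ?thesis
  proof (intro exI allI impI)
    fix N :: nat assume N: "N > 0"
    let ?P = "{p. p \<in> {1..N} \<and> prime p}"
    let ?S = "\<lambda>n. \<Sum>p | p \<in> {1..N} \<and> prime p \<and> p - 1 dvd 3 ^ J * n. ln (real p)"
    define D where "D = real (Suc J) * ln (real N) - C"
    have "real N * (D - 4) \<le> real N * (\<Sum>p\<in>?P. real (gcd (3 ^ J) (p - 1)) * ln (real p) / real p) - 4 * real N"
    proof -
      have "real N * D \<le> real N * (\<Sum>p\<in>?P. real (gcd (3 ^ J) (p - 1)) * ln (real p) / real p)"
        unfolding D_def by (intro mult_left_mono C[OF N]) simp
      thus ?thesis by (simp only: right_diff_distrib)
    qed
    \<comment> \<open>Pays for the rounding loss of 1 in the count for each prime, weighted by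
      \<open>ln p\<close>.\<close>
    also have "4 * real N \<ge> (\<Sum>p\<in>?P. ln (real p))"
    proof -
      have "(\<Sum>p\<in>?P. ln (real p)) = (\<Sum>p\<in>?P. mangoldt p)" by (intro sum.cong) auto
      also have "\<dots> \<le> (\<Sum>p=1..N. mangoldt p)"
        by (intro sum_mono2) (auto intro!: mangoldt_nonneg)
      also have "\<dots> \<le> 4 * real N" by (rule sum_mangoldt_le)
      finally show ?thesis .
    qed
    hence "real N * (\<Sum>p\<in>?P. real (gcd (3 ^ J) (p - 1)) * ln (real p) / real p) - 4 * real N \<le>
           real N * (\<Sum>p\<in>?P. real (gcd (3 ^ J) (p - 1)) * ln (real p) / real p) - (\<Sum>p\<in>?P. ln (real p))"
      by simp
    also have "\<dots> = (\<Sum>p\<in>?P. ln (real p) * (real N * real (gcd (3 ^ J) (p - 1)) / real p - 1))"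
      unfolding sum_distrib_left sum_subtractf[symmetric] by (intro sum.cong refl) (simp add: algebra_simps)
    also have "\<dots> \<le> (\<Sum>p\<in>?P. ln (real p) * real (card {n \<in> {1..N}. p - 1 dvd 3 ^ J * n}))"
    proof (intro sum_mono mult_left_mono)
      fix p assume p: "p \<in> ?P"
      hence p2: "p \<ge> 2" by (auto dest: prime_ge_2_nat)
      \<comment> \<open>The count has denominator \<open>p - 1\<close>, the Mertens sum has
        \<open>p\<close>; the change is in the favourable direction.\<close>
      have "real N * real (gcd (3 ^ J) (p - 1)) / real p \<le> real N * real (gcd (3 ^ J) (p - 1)) / real (p - 1)"
        using p2 by (intro divide_left_mono) auto
      thus "real N * real (gcd (3 ^ J) (p - 1)) / real p - 1 \<le> real (card {n \<in> {1..N}. p - 1 dvd 3 ^ J * n})"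
        using card_dvd_mult_ge[of "p - 1" "3 ^ J" N] p2 by simp
      show "ln (real p) \<ge> 0" using p2 by simp
    qed
    also have "\<dots> = (\<Sum>p\<in>?P. \<Sum>n=1..N. if p - 1 dvd 3 ^ J * n then ln (real p) else 0)"
      by (intro sum.cong refl, subst sum.inter_filter[symmetric]) auto
    also have "\<dots> = (\<Sum>n=1..N. \<Sum>p\<in>?P. if p - 1 dvd 3 ^ J * n then ln (real p) else 0)"
      by (rule sum.swap)
    also have "\<dots> = (\<Sum>n=1..N. ?S n)"
    proof (rule sum.cong[OF refl])
      fix n
      have "{p. p \<in> {1..N} \<and> prime p \<and> p - 1 dvd 3 ^ J * n} = {p \<in> ?P. p - 1 dvd 3 ^ J * n}" by auto
      thus "(\<Sum>p\<in>?P. if p - 1 dvd 3 ^ J * n then ln (real p) else 0) = ?S n"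
        by (simp only:) (rule sum.inter_filter[symmetric], simp)
    qed
    finally have le: "real N * (D - 4) \<le> (\<Sum>n=1..N. ?S n)" .
    show "\<exists>n\<in>{1..N}. ?S n \<ge> real (Suc J) * ln (real N) - (C + 4)"
    proof (rule ccontr)
      assume neg: "\<not> (\<exists>n\<in>{1..N}. ?S n \<ge> real (Suc J) * ln (real N) - (C + 4))"
      have "?S n < D - 4" if "n \<in> {1..N}" for n
      proof (rule ccontr)
        assume "\<not> ?S n < D - 4"
        hence "?S n \<ge> real (Suc J) * ln (real N) - (C + 4)" unfolding D_def by linarith
        with neg that show False by blast
      qed
      hence "(\<Sum>n=1..N. ?S n) < (\<Sum>n=1..N. D - 4)" using N by (intro sum_strict_mono) auto
      thus False using le by simp
    qed
  qed
qed

text \<open>With \<open>J = K\<close> the product of the primes is at least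
  \<open>N ^ (K + 1) / exp C\<close>, while \<open>(L + 1) ^ K\<close> is at most a constant times
  \<open>N ^ K\<close>. The spare factor \<open>N\<close> beats any constant.\<close>

lemma exists_smooth_modulus:
  assumes "\<epsilon> > 0"
  shows "\<exists>P L. finite P \<and> (\<forall>p\<in>P. prime p \<and> p - 1 dvd L) \<and> L > 0 \<and>
           real ((L + 1) ^ K) \<le> \<epsilon> * real (\<Prod>P)"
proof -
  obtain C where C: "\<And>N. N > 0 \<Longrightarrow> \<exists>n\<in>{1..N}.
     (\<Sum>p | p \<in> {1..N} \<and> prime p \<and> p - 1 dvd 3 ^ K * n. ln (real p)) \<ge> real (Suc K) * ln (real N) - C"
    using exists_many_primes_pred_dvd by blast
  \<comment> \<open>This threshold collects the constant from
    \<open>L + 1 \<le> 2 * 3 ^ K * N\<close>, the loss \<open>exp C\<close> and the target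
    \<open>\<epsilon>\<close>.\<close>
  obtain N :: nat where N: "(2 * 3 ^ K) ^ K * exp C / \<epsilon> < real N" using reals_Archimedean2 by blast
  have "N > 0"
  proof (rule Nat.gr0I)
    assume "N = 0"
    moreover have "(2 * 3 ^ K) ^ K * exp C / \<epsilon> > 0" using assms by simp
    ultimately show False using N by simp
  qed
  from C[OF this] obtain n where n: "n \<in> {1..N}"
    and le: "(\<Sum>p | p \<in> {1..N} \<and> prime p \<and> p - 1 dvd 3 ^ K * n. ln (real p)) \<ge> real (Suc K) * ln (real N) - C"
    by blast
  define P where "P = {p. p \<in> {1..N} \<and> prime p \<and> p - 1 dvd 3 ^ K * n}"
  define L where "L = 3 ^ K * n"
  have L: "L > 0" using n by (simp add: L_def)
  have "real ((L + 1) ^ K) \<le> (2 * 3 ^ K * real N) ^ K"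
  proof -
    have "real L = 3 ^ K * real n" by (simp add: L_def)
    also have "\<dots> \<le> 3 ^ K * real N" using n by (intro mult_left_mono) auto
    finally have "real (L + 1) \<le> 2 * 3 ^ K * real N" using L by linarith
    thus ?thesis unfolding of_nat_power by (intro power_mono) auto
  qed
  also have "\<dots> = ((2 * 3 ^ K) ^ K * exp C / \<epsilon>) * real N ^ K * (\<epsilon> / exp C)"
    using assms by (simp add: power_mult_distrib)
  also have "\<dots> \<le> real N * real N ^ K * (\<epsilon> / exp C)"
    using N assms by (intro mult_right_mono) auto
  also have "\<dots> = \<epsilon> * exp (real (Suc K) * ln (real N) - C)"
    using \<open>N > 0\<close> by (simp add: exp_diff exp_of_nat_mult del: of_nat_Suc)
  also have "\<dots> \<le> \<epsilon> * exp (\<Sum>p\<in>P. ln (real p))"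
    using le assms unfolding P_def by (intro mult_left_mono) auto
  also have "exp (\<Sum>p\<in>P. ln (real p)) = real (\<Prod>P)"
  proof -
    have "finite P" by (simp add: P_def)
    hence "exp (\<Sum>p\<in>P. ln (real p)) = (\<Prod>p\<in>P. exp (ln (real p)))" by (rule exp_sum)
    also have "\<dots> = (\<Prod>p\<in>P. real p)" by (intro prod.cong) (auto simp: P_def)
    finally show ?thesis by simp
  qed
  finally have "real ((L + 1) ^ K) \<le> \<epsilon> * real (\<Prod>P)" .
  moreover have "finite P" "\<forall>p\<in>P. prime p \<and> p - 1 dvd L"
    by (auto simp: P_def L_def)
  ultimately show ?thesis using L by blast
qed

section \<open>Counting the residues attained modulo a product of such primes\<close>

lemma prime_dvd_power_minus_1:
  fixes b :: int
  assumes "prime p" "p - 1 dvd L"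
  shows "int p dvd b * (b ^ L - 1)"
\<comment> \<open>The extra factor \<open>b\<close> settles multiples of \<open>p\<close>; otherwise
  Fermat applies to the natural number representing \<open>b\<close> modulo
  \<open>p\<close>.\<close>
proof (cases "int p dvd b")
  case False
  define c where "c = nat (b mod int p)"
  have p: "p > 0" using assms(1) by (simp add: prime_gt_0_nat)
  have c: "int c = b mod int p" using p by (simp add: c_def)
  have "\<not> p dvd c"
    using False c by (metis dvd_mod_iff dvd_refl int_dvd_int_iff)
  hence "[c ^ (p - 1) = 1] (mod p)" by (intro fermat_theorem assms)
  then have "[(c ^ (p - 1)) ^ (L div (p - 1)) = 1 ^ (L div (p - 1))] (mod p)" by (rule cong_pow)
  hence "[c ^ L = 1] (mod p)" using assms(2) by (simp add: power_mult[symmetric])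
  hence "[int c ^ L = 1] (mod int p)" by (metis cong_int_iff of_nat_1 of_nat_power)
  moreover have "[b ^ L = int c ^ L] (mod int p)"
    unfolding c by (intro cong_pow) (simp add: cong_def)
  ultimately have "[b ^ L = 1] (mod int p)" by (rule cong_trans[rotated])
  thus ?thesis by (simp add: cong_iff_dvd_diff)
qed auto

lemma prod_primes_dvd:
  fixes z :: int
  assumes "finite P" "\<And>p. p \<in> P \<Longrightarrow> prime p" "\<And>p. p \<in> P \<Longrightarrow> int p dvd z"
  shows "int (\<Prod>P) dvd z"
  using assms
proof (induction P rule: finite_induct)
  case (insert p P)
  have "coprime p (\<Prod>P)"
    using insert.prems(1) insert.hyps by (intro prod_coprime_right primes_coprime) auto
  hence "coprime (int p) (int (\<Prod>P))" by (simp only: coprime_int_iff)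
  thus ?case using insert by (simp add: divides_mult del: of_nat_prod)
qed auto

text \<open>An exponent above \<open>L\<close> can be lowered by \<open>L\<close> without changing
  the residue. It stays positive, so a factor \<open>b\<close> remains for the divisibility
  assumption.\<close>

lemma power_cong_bounded_exponent:
  fixes b m :: int
  assumes "m dvd b * (b ^ L - 1)" "L > 0"
  shows "\<exists>\<beta>\<le>L. [b ^ \<alpha> = b ^ \<beta>] (mod m)"
proof (induction \<alpha> rule: less_induct)
  case (less \<alpha>)
  show ?case
  proof (cases "\<alpha> \<le> L")
    case False
    define \<gamma> where "\<gamma> = \<alpha> - L - 1"
    have \<alpha>: "\<alpha> = Suc \<gamma> + L" using False by (simp add: \<gamma>_def)
    have "b ^ \<alpha> - b ^ Suc \<gamma> = b ^ \<gamma> * (b * (b ^ L - 1))"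
      by (simp add: \<alpha> power_add algebra_simps)
    hence "[b ^ \<alpha> = b ^ Suc \<gamma>] (mod m)"
      using assms by (simp add: cong_iff_dvd_diff)
    moreover obtain \<beta> where "\<beta> \<le> L" "[b ^ Suc \<gamma> = b ^ \<beta>] (mod m)"
      using less.IH[of "Suc \<gamma>"] assms(2) by (auto simp: \<alpha>)
    ultimately show ?thesis by (blast intro: cong_trans)
  qed (auto intro: exI[of _ \<alpha>])
qed

text \<open>Every attained residue already comes from a \<open>k\<close> by \<open>l\<close> matrix
  of exponents in \<open>{0..L}\<close>.\<close>

lemma card_solvable_residues_le:
  assumes L: "L > 0" and m: "\<And>c. m dvd c * (c ^ L - 1)"
  shows "finite ((\<lambda>c. c mod m) ` {c. cong_solvable k l a b c m})" (is "finite ?R")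
    and "card ((\<lambda>c. c mod m) ` {c. cong_solvable k l a b c m}) \<le> (L + 1) ^ (k * l)"
proof -
  let ?I = "{..<k} \<times> {..<l}"
  \<comment> \<open>Extensional functions on index pairs encode the matrices, making them finite in
    number; \<open>curry\<close> recovers the two-argument form.\<close>
  let ?F = "?I \<rightarrow>\<^sub>E {..L}"
  have sub: "?R \<subseteq> (\<lambda>\<beta>. exp_lhs k l a b (curry \<beta>) mod m) ` ?F"
  proof safe
    fix c assume "cong_solvable k l a b c m"
    then obtain \<alpha> where \<alpha>: "[exp_lhs k l a b \<alpha> = c] (mod m)" by (auto simp: cong_solvable_def)
    have "\<forall>i j. \<exists>\<beta>\<le>L. [b i j ^ \<alpha> i j = b i j ^ \<beta>] (mod m)"
      using power_cong_bounded_exponent[OF m L] by blast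
    then obtain \<beta> where \<beta>: "\<And>i j. \<beta> i j \<le> L" "\<And>i j. [b i j ^ \<alpha> i j = b i j ^ \<beta> i j] (mod m)"
      by metis
    define \<gamma> where "\<gamma> = restrict (\<lambda>(i, j). \<beta> i j) ?I"
    have "[exp_lhs k l a b \<alpha> = exp_lhs k l a b (curry \<gamma>)] (mod m)"
      unfolding exp_lhs_def
      by (intro cong_sum cong_mult cong_prod cong_refl) (use \<beta>(2) in \<open>simp add: \<gamma>_def\<close>)
    hence "c mod m = exp_lhs k l a b (curry \<gamma>) mod m" using \<alpha> by (simp add: cong_def)
    moreover have "\<gamma> \<in> ?F" using \<beta>(1) by (auto simp: \<gamma>_def)
    ultimately show "c mod m \<in> (\<lambda>\<beta>. exp_lhs k l a b (curry \<beta>) mod m) ` ?F" by blast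
  qed
  have fin: "finite ?F" by (intro finite_PiE) auto
  thus "finite ?R" using sub by (blast intro: finite_subset)
  have "card ?R \<le> card ((\<lambda>\<beta>. exp_lhs k l a b (curry \<beta>) mod m) ` ?F)"
    using sub fin by (intro card_mono) auto
  also have "\<dots> \<le> card ?F" using fin by (rule card_image_le)
  also have "\<dots> = (L + 1) ^ (k * l)" by (subst card_PiE) auto
  finally show "card ?R \<le> (L + 1) ^ (k * l)" .
qed

section \<open>From residue classes to integers of bounded absolute value\<close>

lemma int_abs_le_real_eq: "{c. real_of_int \<bar>c\<bar> \<le> x} = {-\<lfloor>x\<rfloor>..\<lfloor>x\<rfloor>}"
  unfolding le_floor_iff[symmetric] by auto

text \<open>An integer is determined by its remainder and quotient modulo \<open>m\<close>. The
  quotients lie between \<open>- x / m - 1\<close> and \<open>x / m\<close>, so there are at most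
  \<open>2 * x / m + 2\<close> of them.\<close>

lemma card_residue_classes_le:
  fixes S :: "int set" and m :: int
  assumes m: "m > 0" and fin: "finite ((\<lambda>c. c mod m) ` S)" and x: "x \<ge> 0"
  shows "real (card {c \<in> S. real_of_int \<bar>c\<bar> \<le> x}) \<le> real (card ((\<lambda>c. c mod m) ` S)) * (2 * x / m + 2)"
proof -
  let ?R = "(\<lambda>c. c mod m) ` S" and ?X = "\<lfloor>x\<rfloor>"
  let ?D = "{(- ?X) div m..?X div m}"
  have "card {c \<in> S. real_of_int \<bar>c\<bar> \<le> x} \<le> card (?R \<times> ?D)"
  proof (rule card_inj_on_le[where f = "\<lambda>c. (c mod m, c div m)"])
    show "inj_on (\<lambda>c. (c mod m, c div m)) {c \<in> S. real_of_int \<bar>c\<bar> \<le> x}"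
      by (intro inj_onI) (metis Pair_inject div_mult_mod_eq)
    show "(\<lambda>c. (c mod m, c div m)) ` {c \<in> S. real_of_int \<bar>c\<bar> \<le> x} \<subseteq> ?R \<times> ?D"
    proof safe
      fix c assume c: "c \<in> S" "real_of_int \<bar>c\<bar> \<le> x"
      hence "\<bar>c\<bar> \<le> ?X" by (simp add: le_floor_iff)
      hence "- ?X \<le> c" "c \<le> ?X" by auto
      thus "c div m \<in> ?D" using m by (auto intro: zdiv_mono1)
    qed auto
  qed (use fin in auto)
  also have "\<dots> = card ?R * card ?D" by (rule card_cartesian_product)
  finally have "real (card {c \<in> S. real_of_int \<bar>c\<bar> \<le> x}) \<le> real (card ?R) * real (card ?D)"
    by (metis of_nat_le_iff of_nat_mult)
  also have "real (card ?D) \<le> 2 * x / m + 2"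
  proof -
    have 1: "real_of_int (?X div m) \<le> x / m"
    proof -
      have "real_of_int (?X div m) \<le> of_int ?X / of_int m" 
        by (metis floor_divide_of_int_eq of_int_floor_le)
      also have "\<dots> \<le> x / m" using m by (intro divide_right_mono) auto
      finally show ?thesis .
    qed
    have 2: "real_of_int ((- ?X) div m) \<ge> - (x / m) - 1"
    proof -
      have "- ?X = m * ((- ?X) div m) + (- ?X) mod m" by simp
      moreover have "(- ?X) mod m < m" using m by simp
      ultimately have "- ?X < m * ((- ?X) div m) + m" by linarith
      hence "- real_of_int ?X < m * real_of_int ((- ?X) div m) + m"
        by (metis of_int_add of_int_less_iff of_int_minus of_int_mult)
      hence "- x \<le> m * real_of_int ((- ?X) div m) + m" using of_int_floor_le[of x] by linarith
      thus ?thesis using m by (simp add: field_simps)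
    qed
    have "?X \<ge> 0" using x by simp
    hence "(- ?X) div m \<le> ?X div m" using m by (intro zdiv_mono1) auto
    hence "real (card ?D) = real_of_int (?X div m) - real_of_int ((- ?X) div m) + 1"
      by simp
    thus ?thesis using 1 2 by simp
  qed
  finally show ?thesis by (simp add: mult_left_mono)
qed

lemma solvable_density_bound:
  assumes "\<epsilon> > 0" "\<epsilon> < 1"
  shows "\<exists>m\<ge>2. \<forall>x\<ge>0. finite {c. cong_solvable k l a b c m \<and> real_of_int \<bar>c\<bar> \<le> x} \<and>
     real (card {c. cong_solvable k l a b c m \<and> real_of_int \<bar>c\<bar> \<le> x}) \<le> \<epsilon> * (2 * x + 2 * real_of_int m)"
proof -
  obtain P L where P: "finite P" "\<And>p. p \<in> P \<Longrightarrow> prime p" "\<And>p. p \<in> P \<Longrightarrow> p - 1 dvd L" "L > 0"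
    and le: "real ((L + 1) ^ (k * l)) \<le> \<epsilon> * real (\<Prod>P)"
    using exists_smooth_modulus[OF assms(1), of "k * l"] by blast
  define m where "m = int (\<Prod>P)"
  have dvd: "m dvd c * (c ^ L - 1)" for c
    unfolding m_def using P by (intro prod_primes_dvd prime_dvd_power_minus_1) auto
  \<comment> \<open>Combined with \<open>\<epsilon> < 1\<close> this forces
    \<open>m \<ge> 2\<close>, the range of moduli occurring in \<open>H\<close>.\<close>
  have "1 \<le> real ((L + 1) ^ (k * l))" by simp
  also note le
  also have "real (\<Prod>P) = real_of_int m" unfolding m_def by (simp only: of_int_of_nat_eq)
  finally have "1 \<le> \<epsilon> * real_of_int m" .
  hence "real_of_int m > 1"
    using assms by (smt (verit) mult_le_cancel_right1 mult_less_cancel_right2 mult_nonneg_nonpos)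
  hence m: "m \<ge> 2" by simp
  let ?S = "{c. cong_solvable k l a b c m}"
  note R = card_solvable_residues_le[OF P(4) dvd, of k l a b]
  show ?thesis
  proof (intro exI[of _ m] conjI allI impI m)
    fix x :: real assume x: "x \<ge> 0"
    show "finite {c. cong_solvable k l a b c m \<and> real_of_int \<bar>c\<bar> \<le> x}"
    proof (rule finite_subset)
      show "finite {c. real_of_int \<bar>c\<bar> \<le> x}" unfolding int_abs_le_real_eq by simp
    qed auto
    have "real (card {c \<in> ?S. real_of_int \<bar>c\<bar> \<le> x}) \<le> real (card ((\<lambda>c. c mod m) ` ?S)) * (2 * x / m + 2)"
      using m x by (intro card_residue_classes_le R(1)) auto
    also have "\<dots> \<le> real ((L + 1) ^ (k * l)) * (2 * x / m + 2)"
      using R(2) m x by (intro mult_right_mono of_nat_mono) auto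
    also have "\<dots> \<le> \<epsilon> * real_of_int m * (2 * x / m + 2)"
      using le m x by (intro mult_right_mono) (auto simp: m_def simp del: of_nat_prod)
    also have "\<dots> = \<epsilon> * (2 * x + 2 * real_of_int m)" using m by (simp add: field_simps)
    finally show "real (card {c. cong_solvable k l a b c m \<and> real_of_int \<bar>c\<bar> \<le> x}) \<le> \<epsilon> * (2 * x + 2 * real_of_int m)"
      by simp
  qed
qed

section \<open>Density\<close>

theorem theorem1:
  fixes k l :: nat and a :: "nat \<Rightarrow> int" and b :: "nat \<Rightarrow> nat \<Rightarrow> int"
  assumes "k \<ge> 1" and "l \<ge> 1"
    and "\<And>i. i < k \<Longrightarrow> a i \<noteq> 0"
    and "\<And>i j. i < k \<Longrightarrow> j < l \<Longrightarrow> b i j \<noteq> 0"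
  shows "((\<lambda>x::real. real (card {c \<in> H k l a b. real_of_int \<bar>c\<bar> \<le> x})
                   / real (card {c \<in> H0 k l a b. real_of_int \<bar>c\<bar> \<le> x}))
          \<longlongrightarrow> 0) at_top"
proof (rule tendstoI)
  fix e :: real assume e: "e > 0"
  \<comment> \<open>The bound \<open>e / 4\<close> makes the final ratio
    \<open>3 * \<epsilon>\<close> smaller than \<open>e\<close>; the bound \<open>1 / 4\<close>
    keeps the denominator at least \<open>x\<close>.\<close>
  define \<epsilon> where "\<epsilon> = min (1 / 4) (e / 4)"
  have \<epsilon>: "\<epsilon> > 0" "\<epsilon> < 1" "\<epsilon> \<le> 1 / 4" "3 * \<epsilon> < e" using e by (auto simp: \<epsilon>_def min_def)
  obtain m where m: "m \<ge> 2"
    and fin: "\<And>x. x \<ge> 0 \<Longrightarrow> finite {c. cong_solvable k l a b c m \<and> real_of_int \<bar>c\<bar> \<le> x}"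
    and le: "\<And>x. x \<ge> 0 \<Longrightarrow> real (card {c. cong_solvable k l a b c m \<and> real_of_int \<bar>c\<bar> \<le> x})
       \<le> \<epsilon> * (2 * x + 2 * real_of_int m)"
    using solvable_density_bound[OF \<epsilon>(1,2)] by blast
  show "\<forall>\<^sub>F x in at_top. dist (real (card {c \<in> H k l a b. real_of_int \<bar>c\<bar> \<le> x})
                   / real (card {c \<in> H0 k l a b. real_of_int \<bar>c\<bar> \<le> x})) 0 < e"
    \<comment> \<open>For \<open>x \<ge> 2 * m\<close> the count \<open>2 * x + 2 * m\<close> is at
      most \<open>3 * x\<close>, and \<open>m \<ge> 2\<close> gives
      \<open>x \<ge> 4\<close>.\<close>
    using eventually_ge_at_top[of "2 * real_of_int m"]
  proof eventually_elim
    case (elim x)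
    have x: "x \<ge> 4" using elim m by linarith
    let ?S = "{c. cong_solvable k l a b c m \<and> real_of_int \<bar>c\<bar> \<le> x}"
    let ?U = "{c \<in> H k l a b. real_of_int \<bar>c\<bar> \<le> x}" and ?V = "{c \<in> H0 k l a b. real_of_int \<bar>c\<bar> \<le> x}"
    have finS: "finite ?S" using fin x by simp
    have "real (card ?S) \<le> \<epsilon> * (2 * x + 2 * real_of_int m)" using le x by simp
    also have "\<dots> \<le> \<epsilon> * (3 * x)" using elim \<epsilon> by (intro mult_left_mono) auto
    finally have S: "real (card ?S) \<le> \<epsilon> * (3 * x)" .
    have H: "real (card ?U) \<le> \<epsilon> * (3 * x)"
    proof -
      have "card ?U \<le> card ?S" using m by (intro card_mono finS) (auto simp: H_def)
      thus ?thesis using S by linarith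
    qed
    \<comment> \<open>At least \<open>2 * x - 1\<close> integers are available and at most
      \<open>3 * x / 4\<close> lie in \<open>?S\<close>; the remaining \<open>5 * x / 4 - 1\<close>
      is at least \<open>x\<close> since \<open>x \<ge> 4\<close>.\<close>
    have "x \<le> real (card ?V)"
    proof -
      have "\<lfloor>x\<rfloor> \<ge> 0" using x by simp
      hence "real (card {c. real_of_int \<bar>c\<bar> \<le> x}) = 2 * real_of_int \<lfloor>x\<rfloor> + 1"
        unfolding int_abs_le_real_eq by simp
      hence "2 * x - 1 \<le> real (card {c. real_of_int \<bar>c\<bar> \<le> x})"
        using real_of_int_floor_add_one_ge[of x] by linarith
      also have "card {c. real_of_int \<bar>c\<bar> \<le> x} \<le> card (?S \<union> ?V)"
      proof (rule card_mono)
        have "?V \<subseteq> {c. real_of_int \<bar>c\<bar> \<le> x}" by auto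
        thus "finite (?S \<union> ?V)" using finS unfolding int_abs_le_real_eq by (auto intro: finite_subset)
        \<comment> \<open>An integer outside \<open>H0\<close> solves the equation, hence also the
          congruence modulo \<open>m\<close>.\<close>
        show "{c. real_of_int \<bar>c\<bar> \<le> x} \<subseteq> ?S \<union> ?V"
          by (auto simp: H0_def eq_solvable_def cong_solvable_def intro: cong_refl)
      qed
      also have "\<dots> \<le> card ?S + card ?V" by (rule card_Un_le)
      finally have "2 * x - 1 \<le> real (card ?S) + real (card ?V)" by simp
      moreover have "\<epsilon> * (3 * x) \<le> 1 / 4 * (3 * x)" using \<epsilon> x by (intro mult_right_mono) auto
      ultimately show ?thesis using S x by linarith
    qed
    hence "real (card ?U) / real (card ?V) \<le> \<epsilon> * (3 * x) / x"
      using H x \<epsilon> by (intro frac_le) auto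
    also have "\<dots> < e" using x \<epsilon> by simp
    finally show ?case by simp
  qed
qed

end
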